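(* Let $T$ be a locally finite infinite tree. Then $\mathrm{DN}_{\mathrm{LLY}}(T)<\infty$ if and only if exactly one of the following holds: (i) $T$ is a double ray; (ii) $T$ is obtained from a finite tree by attaching one degree-two ray. Equivalently, case (ii) consists precisely of the one-ended trees with finitely many branch vertices (i.e. a locally finite infinite tree is of the form (ii) if and only if it has exactly one end and only finitely many branch vertices). Moreover, whenever $D:=\mathrm{DN}_{\mathrm{LLY}}(T)<\infty$, $$|B(T)|\le\lceil D\rceil .$$ Thus every infinite tree of finite distortion has at most two ends, with two ends only in the double-ray case.
   Context: Graphs are simple and undirected. Let $d(\cdot,\cdot)$ be the combinatorial graph distance. For a positive edge weight $w:E\to(0,\infty)$ put $d_x^w:=\sum_{y\sim x}w_{xy}$. For $\alpha\in[0,1]$ let $\mu_x^{\alpha,w}$ be the probability measure with $\mu_x^{\alpha,w}(x)=\alpha$, $\mu_x^{\alpha,w}(z)=(1-\alpha)w_{xz}/d_x^w$ for $z\sim x$, and $0$ otherwise. Let $W_1$ be the $1$-Wasserstein distance with respect to $d$. For $x\sim y$ let $\kappa_\alpha^w(x,y):=1-W_1(\mu_x^{\alpha,w},\mu_y^{\alpha,w})$ and define the weighted Lin--Lu--Yau curvature $\kappa_{\mathrm{LLY}}^w(x,y):=\lim_{\alpha\to1^-}\kappa_\alpha^w(x,y)/(1-\alpha)$. For connected locally finite $G$ with $E\neq\varnothing$: $\mathrm{Dist}(w):=\sup_{e\in E}w_e/\inf_{e\in E}w_e$, with value $+\infty$ if the supremum is infinite or the infimum is $0$; a positive weight $w$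 is admissible if $\kappa_{\mathrm{LLY}}^w(e)\ge0$ for every $e\in E$; and $\mathrm{DN}_{\mathrm{LLY}}(G):=\inf\{\mathrm{Dist}(w): w \text{ admissible}\}$, with value $+\infty$ if no admissible weight has finite distortion. $B(T):=\{v\in V(T): d_v\ge3\}$ is the set of branch vertices, $d_v$ being the degree. A ray is a one-way infinite simple path $v_0v_1v_2\cdots$; a double ray is a simple path $\cdots v_{-1}v_0v_1\cdots$ indexed by $\mathbb Z$. A ray $R$ in $T$ is a degree-two ray if every vertex of $R$ has degree $2$ in $T$. Two rays determine the same end if for every finite vertex set $S$ sufficiently long tails of both lie in the same component of the graph minus $S$ (for trees: they have a common tail). "Obtained from a finite tree $K$ by attaching one degree-two ray" means: $T$ is the disjoint union of a finite tree $K$ (possibly a single vertex) and a ray $R$, together with one edge joining a vertex of $K$ to the initial vertex of $R$, so that all vertices of $R$ have degree $2$ in $T$ (in particular a single ray is of this form, with $K$ a single vertex). *)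

theory Defs
  imports "HOL-Probability.Probability_Mass_Function"
begin

text \<open>
  A simple undirected graph is a vertex set \<open>V\<close> together with a set \<open>E\<close> of two-element
  subsets of \<open>V\<close>; notions that do not mention isolated vertices take \<open>E\<close> alone.
\<close>

definition simple_graph :: "'a set \<Rightarrow> 'a set set \<Rightarrow> bool" where
  "simple_graph V E \<longleftrightarrow> (\<forall>e\<in>E. e \<subseteq> V \<and> card e = 2)"

definition adj_rel :: "'a set set \<Rightarrow> 'a rel" where
  "adj_rel E = {(x, y). {x, y} \<in> E}"

definition nbrs :: "'a set set \<Rightarrow> 'a \<Rightarrow> 'a set" where
  "nbrs E x = {y. {x, y} \<in> E}"

definition degree :: "'a set set \<Rightarrow> 'a \<Rightarrow> nat" where
  "degree E x = card (nbrs E x)"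

definition locally_finite :: "'a set \<Rightarrow> 'a set set \<Rightarrow> bool" where
  "locally_finite V E \<longleftrightarrow> (\<forall>x\<in>V. finite (nbrs E x))"

definition connected_graph :: "'a set \<Rightarrow> 'a set set \<Rightarrow> bool" where
  "connected_graph V E \<longleftrightarrow>
     simple_graph V E \<and> V \<noteq> {} \<and> (\<forall>x\<in>V. \<forall>y\<in>V. (x, y) \<in> (adj_rel E)\<^sup>*)"

definition is_cycle :: "'a set set \<Rightarrow> 'a list \<Rightarrow> bool" where
  "is_cycle E xs \<longleftrightarrow> length xs \<ge> 3 \<and> distinct xs \<and>
     successively (\<lambda>x y. {x, y} \<in> E) xs \<and> {last xs, hd xs} \<in> E"

definition is_tree :: "'a set \<Rightarrow> 'a set set \<Rightarrow> bool" where
  "is_tree V E \<longleftrightarrow> connected_graph V E \<and> (\<nexists>xs. is_cycle E xs)"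

text \<open>Length of a shortest walk; only meaningful for vertices joined by some walk.\<close>

definition graph_dist :: "'a set set \<Rightarrow> 'a \<Rightarrow> 'a \<Rightarrow> nat" where
  "graph_dist E x y = (LEAST n. (x, y) \<in> adj_rel E ^^ n)"

definition couplings :: "'a pmf \<Rightarrow> 'a pmf \<Rightarrow> ('a \<times> 'a) pmf set" where
  "couplings p q = {\<pi>. map_pmf fst \<pi> = p \<and> map_pmf snd \<pi> = q}"

definition wasserstein1 :: "('a \<Rightarrow> 'a \<Rightarrow> real) \<Rightarrow> 'a pmf \<Rightarrow> 'a pmf \<Rightarrow> ennreal" where
  "wasserstein1 d p q =
     (INF \<pi>\<in>couplings p q. \<integral>\<^sup>+ z. ennreal (d (fst z) (snd z)) \<partial>measure_pmf \<pi>)"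

definition wdegree :: "'a set set \<Rightarrow> ('a set \<Rightarrow> real) \<Rightarrow> 'a \<Rightarrow> real" where
  "wdegree E w x = (\<Sum>y\<in>nbrs E x. w {x, y})"

text \<open>
  The lazy random-walk measure. The given function is a probability mass function, so that
  \<open>embed_pmf\<close> has its intended meaning, whenever \<open>0 \<le> \<alpha> \<le> 1\<close>, \<open>w\<close> is positive on \<open>E\<close>, and
  \<open>x\<close> has finitely many but at least one neighbour in a simple graph.
\<close>

definition lazy_walk :: "'a set set \<Rightarrow> ('a set \<Rightarrow> real) \<Rightarrow> real \<Rightarrow> 'a \<Rightarrow> 'a pmf" where
  "lazy_walk E w \<alpha> x = embed_pmf (\<lambda>z.
     if z = x then \<alpha>
     else if z \<in> nbrs E x then (1 - \<alpha>) * w {x, z} / wdegree E w x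
     else 0)"

definition kappa :: "'a set set \<Rightarrow> ('a set \<Rightarrow> real) \<Rightarrow> real \<Rightarrow> 'a \<Rightarrow> 'a \<Rightarrow> real" where
  "kappa E w \<alpha> x y =
     1 - enn2real (wasserstein1 (\<lambda>u v. real (graph_dist E u v))
                     (lazy_walk E w \<alpha> x) (lazy_walk E w \<alpha> y))"

definition kappa_LLY :: "'a set set \<Rightarrow> ('a set \<Rightarrow> real) \<Rightarrow> 'a \<Rightarrow> 'a \<Rightarrow> real" where
  "kappa_LLY E w x y = Lim (at_left 1) (\<lambda>\<alpha>. kappa E w \<alpha> x y / (1 - \<alpha>))"

definition admissible :: "'a set set \<Rightarrow> ('a set \<Rightarrow> real) \<Rightarrow> bool" where
  "admissible E w \<longleftrightarrow> (\<forall>e\<in>E. 0 < w e) \<and> (\<forall>x y. {x, y} \<in> E \<longrightarrow> 0 \<le> kappa_LLY E w x y)"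

definition distortion :: "'a set set \<Rightarrow> ('a set \<Rightarrow> real) \<Rightarrow> ereal" where
  "distortion E w =
     (let s = (SUP e\<in>E. ereal (w e)); i = (INF e\<in>E. ereal (w e))
      in if s = \<infinity> \<or> i = 0 then \<infinity> else s / i)"

text \<open>The infimum of the empty set in \<^typ>\<open>ereal\<close> is \<open>\<infinity>\<close>.\<close>

definition DN_LLY :: "'a set set \<Rightarrow> ereal" where
  "DN_LLY E = (INF w\<in>{w. admissible E w}. distortion E w)"

definition branch_vertices :: "'a set \<Rightarrow> 'a set set \<Rightarrow> 'a set" where
  "branch_vertices V E = {v\<in>V. degree E v \<ge> 3}"

definition is_ray :: "'a set set \<Rightarrow> (nat \<Rightarrow> 'a) \<Rightarrow> bool" where
  "is_ray E r \<longleftrightarrow> inj r \<and> (\<forall>n. {r n, r (Suc n)} \<in> E)"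

definition degree_two_ray :: "'a set set \<Rightarrow> (nat \<Rightarrow> 'a) \<Rightarrow> bool" where
  "degree_two_ray E r \<longleftrightarrow> is_ray E r \<and> (\<forall>n. degree E (r n) = 2)"

definition same_component_minus :: "'a set \<Rightarrow> 'a set set \<Rightarrow> 'a set \<Rightarrow> 'a \<Rightarrow> 'a \<Rightarrow> bool" where
  "same_component_minus V E S x y \<longleftrightarrow>
     x \<in> V - S \<and> y \<in> V - S \<and> (x, y) \<in> (adj_rel {e\<in>E. e \<inter> S = {}})\<^sup>*"

definition end_rel :: "'a set \<Rightarrow> 'a set set \<Rightarrow> (nat \<Rightarrow> 'a) rel" where
  "end_rel V E = {(r, s). is_ray E r \<and> is_ray E s \<and>
     (\<forall>S. S \<subseteq> V \<and> finite S \<longrightarrow>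
        (\<exists>N. \<forall>m\<ge>N. \<forall>n\<ge>N. same_component_minus V E S (r m) (s n)))}"

definition ends :: "'a set \<Rightarrow> 'a set set \<Rightarrow> (nat \<Rightarrow> 'a) set set" where
  "ends V E = {r. is_ray E r} // end_rel V E"

text \<open>The whole graph is a double ray (not merely: contains one).\<close>

definition is_double_ray_graph :: "'a set \<Rightarrow> 'a set set \<Rightarrow> bool" where
  "is_double_ray_graph V E \<longleftrightarrow>
     (\<exists>p :: int \<Rightarrow> 'a. inj p \<and> V = range p \<and> E = (\<Union>i. {{p i, p (i + 1)}}))"

definition finite_tree_with_ray :: "'a set \<Rightarrow> 'a set set \<Rightarrow> bool" where
  "finite_tree_with_ray V E \<longleftrightarrow>
     (\<exists>VK EK r k. is_tree VK EK \<and> finite VK \<and> k \<in> VK \<and>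
        inj r \<and> VK \<inter> range r = {} \<and>
        V = VK \<union> range r \<and>
        E = EK \<union> {{k, r 0}} \<union> (\<Union>n. {{r n, r (Suc n)}}) \<and>
        degree_two_ray E r)"

end

theory Submission
  imports Defs
begin

text \<open>
  On a tree the curvature of an edge \<open>xy\<close> of weight \<open>w\<close> is \<open>2 w (1 / d\<^sub>x + 1 / d\<^sub>y) - 2\<close>, by Kantorovich
  duality with a potential that increases along all paths through the edge. It is nonnegative iff
  \<open>(d\<^sub>x - w) (d\<^sub>y - w) \<le> w\<^sup>2\<close>. Hence an admissible weight is log-concave along every ray, and if it is
  bounded below by \<open>m > 0\<close>, it is nondecreasing along every ray. Orienting the tree towards a fixed
  end, it follows that the edge above a vertex weighs at least as much as all edges below it
  together. So if two rays leave in opposite directions the weight is constant along the double ray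
  they form and nothing can branch off; otherwise every branch vertex costs at least \<open>m\<close>, which
  bounds the number of branch vertices by the distortion. Conversely, a finite tree with one
  degree-two ray carries a weight decaying superexponentially with the distance from the ray.
\<close>

section \<open>Curvature of an edge with a tight potential\<close>

text \<open>The orientation is towards an end and not towards a root because a lower bound on a
  log-concave sequence rules out a decrease only if the sequence never stops. Towards an end, every
  edge is the first edge of an infinite path, so weights grow upwards at every vertex; this turns
  the quadratic edge inequality into the linear one between the edge above a vertex and the edges
  below it. The two shapes of the tree then correspond to whether or not some vertex has infinitely
  many descendants. They exclude each other because a finite tree with a ray attached has a leaf.
  For the curvature no particular transport plan has to be designed: once the common mass at
  \<open>x\<close> and \<open>y\<close> stays put, the remaining mass sits on the side of
  \<open>x\<close> and its targets on the side of \<open>y\<close>, so every coupling of the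
  remainders is optimal, for instance the independent one.\<close>

lemma coupling_with_common_part:
  fixes P Q :: "'a pmf" and c :: "'a \<Rightarrow> real"
  assumes fin: "finite (set_pmf P)" "finite (set_pmf Q)"
    and c: "\<And>z. 0 \<le> c z" "\<And>z. c z \<le> pmf P z" "\<And>z. c z \<le> pmf Q z"
  obtains \<pi> where "\<pi> \<in> couplings P Q"
    and "\<And>u v. (u, v) \<in> set_pmf \<pi> \<Longrightarrow>
           u = v \<and> 0 < c u \<or> c u < pmf P u \<and> c v < pmf Q v"
proof -
  define S where "S = set_pmf P \<union> set_pmf Q"
  have finS: "finite S" using fin by (simp add: S_def)
  define R1 where "R1 = (\<lambda>z. pmf P z - c z)"
  define R2 where "R2 = (\<lambda>z. pmf Q z - c z)"
  define m where "m = 1 - sum c S"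
  \<comment> \<open>The common mass stays on the diagonal; the remainders, both of total mass
    \<open>m\<close>, are coupled independently. If \<open>m = 0\<close> both remainders vanish, and
    division by zero, which yields 0, gives the correct second summand.\<close>
  define g where "g = (\<lambda>(u, v). (if u = v then c u else 0) + R1 u * R2 v / m)"
  have sumP: "sum (pmf P) S = 1" and sumQ: "sum (pmf Q) S = 1"
    using finS by (auto simp: S_def intro: sum_pmf_eq_1)
  have sR: "sum R1 S = m" "sum R2 S = m"
    using sumP sumQ by (simp_all add: R1_def R2_def m_def sum_subtractf)
  have R0: "0 \<le> R1 z" "0 \<le> R2 z" for z using c by (simp_all add: R1_def R2_def)
  have m0: "0 \<le> m" using sR(1) R0 by (metis sum_nonneg)
  have g0: "0 \<le> g z" for z
    using c(1) R0 m0 by (auto simp: g_def split: prod.split)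
  have mz: "R1 z = 0 \<and> R2 z = 0" if "m = 0" "z \<in> S" for z
    using that sR R0 finS by (metis sum_nonneg_eq_0_iff)
  have out: "c z = 0 \<and> R1 z = 0 \<and> R2 z = 0" if "z \<notin> S" for z
  proof -
    have "pmf P z = 0" "pmf Q z = 0" using that by (auto simp: S_def set_pmf_iff)
    then show ?thesis using c[of z] by (simp add: R1_def R2_def)
  qed
  have row: "(\<Sum>v\<in>S. g (u, v)) = pmf P u" if "u \<in> S" for u
  proof -
    have "(\<Sum>v\<in>S. g (u, v)) = c u + R1 u * (m / m)"
      using that finS by (simp add: g_def sum.distrib flip: sum_divide_distrib sum_distrib_left sR(2))
    also have "\<dots> = pmf P u" using mz[OF _ that] by (cases "m = 0") (auto simp: R1_def)
    finally show ?thesis .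
  qed
  have col: "(\<Sum>u\<in>S. g (u, v)) = pmf Q v" if "v \<in> S" for v
  proof -
    have "(\<Sum>u\<in>S. g (u, v)) = c v + (m / m) * R2 v"
      using that finS by (simp add: g_def sum.distrib flip: sum_divide_distrib sum_distrib_right sR(1))
    also have "\<dots> = pmf Q v" using mz[OF _ that] by (cases "m = 0") (auto simp: R2_def)
    finally show ?thesis .
  qed
  have gout: "g z = 0" if "z \<notin> S \<times> S" for z
    using that out by (cases z) (auto simp: g_def)
  have "(\<integral>\<^sup>+ z. ennreal (g z) \<partial>count_space UNIV) = (\<Sum>z\<in>S \<times> S. ennreal (g z))"
    by (rule nn_integral_count_space') (use finS gout in auto)
  also have "\<dots> = ennreal (\<Sum>z\<in>S \<times> S. g z)" using g0 by (simp add: sum_ennreal)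
  also have "(\<Sum>z\<in>S \<times> S. g z) = (\<Sum>u\<in>S. \<Sum>v\<in>S. g (u, v))"
    by (simp add: sum.cartesian_product)
  also have "\<dots> = 1" using row sumP by simp
  finally have g1: "(\<integral>\<^sup>+ z. ennreal (g z) \<partial>count_space UNIV) = 1" by simp
  define \<pi> where "\<pi> = embed_pmf g"
  have pmf_pi: "pmf \<pi> z = g z" for z
    unfolding \<pi>_def using g0 g1 by (rule pmf_embed_pmf)
  have supp: "set_pmf \<pi> \<subseteq> S \<times> S"
    using gout pmf_pi by (auto simp: set_pmf_iff) (metis SigmaD1 SigmaD2)+
  have m1: "map_pmf fst \<pi> = P"
  proof (rule pmf_eqI)
    fix u
    show "pmf (map_pmf fst \<pi>) u = pmf P u"
    proof (cases "u \<in> S")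
      case True
      have "pmf (map_pmf fst \<pi>) u = measure \<pi> (fst -` {u} \<inter> set_pmf \<pi>)"
        by (simp add: pmf_map measure_Int_set_pmf)
      also have "fst -` {u} \<inter> set_pmf \<pi> = Pair u ` S \<inter> set_pmf \<pi>" using supp by auto
      also have "measure \<pi> \<dots> = (\<Sum>z\<in>Pair u ` S. pmf \<pi> z)"
        using finS by (simp add: measure_Int_set_pmf measure_measure_pmf_finite)
      also have "\<dots> = pmf P u" using row[OF True] by (simp add: sum.reindex inj_on_def pmf_pi)
      finally show ?thesis .
    next
      case False
      then have "u \<notin> set_pmf (map_pmf fst \<pi>)" "u \<notin> set_pmf P" using supp by (auto simp: S_def)
      then show ?thesis unfolding set_pmf_iff by simp
    qed
  qed
  have m2: "map_pmf snd \<pi> = Q"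
  proof (rule pmf_eqI)
    fix v
    show "pmf (map_pmf snd \<pi>) v = pmf Q v"
    proof (cases "v \<in> S")
      case True
      have "pmf (map_pmf snd \<pi>) v = measure \<pi> (snd -` {v} \<inter> set_pmf \<pi>)"
        by (simp add: pmf_map measure_Int_set_pmf)
      also have "snd -` {v} \<inter> set_pmf \<pi> = (\<lambda>u. (u, v)) ` S \<inter> set_pmf \<pi>" using supp by auto
      also have "measure \<pi> \<dots> = (\<Sum>z\<in>(\<lambda>u. (u, v)) ` S. pmf \<pi> z)"
        using finS by (simp add: measure_Int_set_pmf measure_measure_pmf_finite)
      also have "\<dots> = pmf Q v" using col[OF True] by (simp add: sum.reindex inj_on_def pmf_pi)
      finally show ?thesis .
    next
      case False
      then have "v \<notin> set_pmf (map_pmf snd \<pi>)" "v \<notin> set_pmf Q" using supp by (auto simp: S_def)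
      then show ?thesis unfolding set_pmf_iff by simp
    qed
  qed
  show thesis
  proof (rule that)
    show "\<pi> \<in> couplings P Q" using m1 m2 by (simp add: couplings_def)
    fix u v assume "(u, v) \<in> set_pmf \<pi>"
    then have "g (u, v) \<noteq> 0" by (simp add: set_pmf_iff pmf_pi)
    then have "u = v \<and> c u \<noteq> 0 \<or> R1 u \<noteq> 0 \<and> R2 v \<noteq> 0"
      by (auto simp: g_def split: if_splits)
    then show "u = v \<and> 0 < c u \<or> c u < pmf P u \<and> c v < pmf Q v"
      using c(1)[of u] R0(1)[of u] R0(2)[of v] by (auto simp: R1_def R2_def)
  qed
qed

text \<open>Complementary slackness: a coupling supported where a dual potential is tight is optimal.\<close>

lemma wasserstein1_eq_potential:
  fixes P Q :: "'a pmf" and f :: "'a \<Rightarrow> real"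
  assumes fin: "finite (set_pmf P)" "finite (set_pmf Q)"
    and d0: "\<And>u v. 0 \<le> d u v"
    and lip: "\<And>u v. u \<in> set_pmf P \<Longrightarrow> v \<in> set_pmf Q \<Longrightarrow> f v - f u \<le> d u v"
    and \<pi>: "\<pi> \<in> couplings P Q"
    and tight: "\<And>u v. (u, v) \<in> set_pmf \<pi> \<Longrightarrow> d u v = f v - f u"
  shows "wasserstein1 d P Q =
    ennreal (measure_pmf.expectation Q f - measure_pmf.expectation P f)"
proof -
  have key: "finite (set_pmf \<rho>)" "set_pmf \<rho> \<subseteq> set_pmf P \<times> set_pmf Q"
    "measure_pmf.expectation \<rho> (\<lambda>z. f (snd z) - f (fst z)) =
      measure_pmf.expectation Q f - measure_pmf.expectation P f"
    if "\<rho> \<in> couplings P Q" for \<rho>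
  proof -
    have m: "map_pmf fst \<rho> = P" "map_pmf snd \<rho> = Q" using that by (auto simp: couplings_def)
    show s: "set_pmf \<rho> \<subseteq> set_pmf P \<times> set_pmf Q"
      unfolding m[symmetric] by (force simp: image_iff)
    show f: "finite (set_pmf \<rho>)" using s fin by (meson finite_SigmaI finite_subset)
    have "measure_pmf.expectation \<rho> (\<lambda>z. f (snd z) - f (fst z)) =
        measure_pmf.expectation \<rho> (\<lambda>z. f (snd z)) - measure_pmf.expectation \<rho> (\<lambda>z. f (fst z))"
      by (rule Bochner_Integration.integral_diff) (use f in \<open>auto intro: integrable_measure_pmf_finite\<close>)
    also have "\<dots> = measure_pmf.expectation (map_pmf snd \<rho>) f - measure_pmf.expectation (map_pmf fst \<rho>) f"
      by simp
    finally show "measure_pmf.expectation \<rho> (\<lambda>z. f (snd z) - f (fst z)) =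
      measure_pmf.expectation Q f - measure_pmf.expectation P f" by (simp only: m)
  qed
  let ?c = "\<lambda>\<rho>. \<integral>\<^sup>+ z. ennreal (d (fst z) (snd z)) \<partial>measure_pmf \<rho>"
  have cost: "?c \<rho> = ennreal (measure_pmf.expectation \<rho> (\<lambda>z. d (fst z) (snd z)))"
    if "\<rho> \<in> couplings P Q" for \<rho>
    by (rule nn_integral_eq_integral)
      (use key(1)[OF that] d0 in \<open>auto intro: integrable_measure_pmf_finite\<close>)
  have lower: "ennreal (measure_pmf.expectation Q f - measure_pmf.expectation P f) \<le> ?c \<rho>"
    if "\<rho> \<in> couplings P Q" for \<rho>
    unfolding cost[OF that] key(3)[OF that, symmetric]
    by (intro ennreal_leI integral_mono_AE)
      (use key(1,2)[OF that] lip in \<open>auto intro!: integrable_measure_pmf_finite simp: AE_measure_pmf_iff\<close>)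
  have upper: "?c \<pi> = ennreal (measure_pmf.expectation Q f - measure_pmf.expectation P f)"
    unfolding cost[OF \<pi>] key(3)[OF \<pi>, symmetric]
    by (intro arg_cong[where f = ennreal] integral_cong_AE)
      (use tight in \<open>auto simp: AE_measure_pmf_iff\<close>)
  show ?thesis unfolding wasserstein1_def
    by (rule antisym) (use \<pi> upper lower in \<open>auto intro: INF_lower2 INF_greatest\<close>)
qed

section \<open>Lazy walks, Lipschitz potentials and the curvature formula\<close>

lemma pmf_lazy_walk:
  assumes a: "0 \<le> \<alpha>" "\<alpha> \<le> 1" and fin: "finite (nbrs E x)" and ne: "nbrs E x \<noteq> {}"
    and irr: "{x, x} \<notin> E" and pos: "\<And>e. e \<in> E \<Longrightarrow> 0 < w e"
  shows "pmf (lazy_walk E w \<alpha> x) z = (if z = x then \<alpha>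
     else if z \<in> nbrs E x then (1 - \<alpha>) * w {x, z} / wdegree E w x else 0)" (is "_ = ?g z")
  unfolding lazy_walk_def
proof (rule pmf_embed_pmf)
  have D: "0 < wdegree E w x" unfolding wdegree_def
    by (rule sum_pos) (use fin ne pos in \<open>auto simp: nbrs_def\<close>)
  show g0: "0 \<le> ?g z" for z
    using a D pos by (auto simp: nbrs_def less_imp_le)
  have x: "x \<notin> nbrs E x" using irr by (simp add: nbrs_def)
  have "(\<integral>\<^sup>+ z. ennreal (?g z) \<partial>count_space UNIV) = (\<Sum>z\<in>insert x (nbrs E x). ennreal (?g z))"
    by (rule nn_integral_count_space') (use fin in auto)
  also have "\<dots> = ennreal (\<Sum>z\<in>insert x (nbrs E x). ?g z)" using g0 by (simp add: sum_ennreal)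
  also have "(\<Sum>z\<in>insert x (nbrs E x). ?g z) = \<alpha> + (\<Sum>z\<in>nbrs E x. ?g z)"
    using fin x by simp
  also have "(\<Sum>z\<in>nbrs E x. ?g z) = (\<Sum>z\<in>nbrs E x. (1 - \<alpha>) * w {x, z} / wdegree E w x)"
    by (rule sum.cong) (use x in auto)
  also have "\<dots> = (1 - \<alpha>) * (\<Sum>z\<in>nbrs E x. w {x, z}) / wdegree E w x"
    by (simp add: sum_distrib_left sum_divide_distrib)
  finally show "(\<integral>\<^sup>+ z. ennreal (?g z) \<partial>count_space UNIV) = 1" using D by (simp flip: wdegree_def)
qed

lemma walk_potential_le:
  assumes "\<And>u v. {u, v} \<in> E \<Longrightarrow> \<bar>f u - f v\<bar> \<le> (1 :: real)" and "(u, v) \<in> adj_rel E ^^ n"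
  shows "\<bar>f v - f u\<bar> \<le> real n"
  using assms(2)
proof (induction n arbitrary: v)
  case (Suc n)
  then obtain y where "(u, y) \<in> adj_rel E ^^ n" "{y, v} \<in> E" by (auto simp: adj_rel_def)
  then show ?case using Suc.IH[of y] assms(1)[of y v] by simp
qed simp

lemma graph_dist_le: "(u, v) \<in> adj_rel E ^^ n \<Longrightarrow> graph_dist E u v \<le> n"
  unfolding graph_dist_def by (rule Least_le)

text \<open>The assumed walk ensures that the \<open>LEAST\<close> in \<open>graph_dist\<close> is
  attained; its length is irrelevant to the bound.\<close>

lemma potential_le_graph_dist:
  assumes "\<And>u v. {u, v} \<in> E \<Longrightarrow> \<bar>f u - f v\<bar> \<le> (1 :: real)" and "(u, v) \<in> adj_rel E ^^ n"
  shows "f v - f u \<le> real (graph_dist E u v)"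
proof -
  have "(u, v) \<in> adj_rel E ^^ graph_dist E u v"
    unfolding graph_dist_def using assms(2) by (rule LeastI)
  then show ?thesis using walk_potential_le[OF assms(1)] by fastforce
qed

lemma relpow_2I: "(a, b) \<in> R \<Longrightarrow> (b, c) \<in> R \<Longrightarrow> (a, c) \<in> R ^^ 2"
  by (auto simp: numeral_2_eq_2)

lemma relpow_3I: "(a, b) \<in> R \<Longrightarrow> (b, c) \<in> R \<Longrightarrow> (c, d) \<in> R \<Longrightarrow> (a, d) \<in> R ^^ 3"
  by (auto simp: numeral_3_eq_3)

text \<open>The hypotheses on \<open>f\<close> say that it is a Kantorovich potential which increases along every
  path running from the neighbours of \<open>x\<close> through the edge \<open>xy\<close> to the neighbours of \<open>y\<close>.\<close>

lemma kappa_eq: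
  fixes f :: "'a \<Rightarrow> real"
  assumes lip: "\<And>u v. {u, v} \<in> E \<Longrightarrow> \<bar>f u - f v\<bar> \<le> 1"
    and irr: "\<And>u. {u, u} \<notin> E" and xy: "{x, y} \<in> E"
    and fin: "finite (nbrs E x)" "finite (nbrs E y)"
    and pos: "\<And>e. e \<in> E \<Longrightarrow> 0 < w e"
    and f: "f x = 0" "f y = 1" "\<And>z. z \<in> nbrs E x \<Longrightarrow> z \<noteq> y \<Longrightarrow> f z = -1"
      "\<And>z. z \<in> nbrs E y \<Longrightarrow> z \<noteq> x \<Longrightarrow> f z = 2"
    and a: "1 / 2 < \<alpha>" "\<alpha> < 1"
  shows "kappa E w \<alpha> x y =
    (1 - \<alpha>) * (2 * (w {x, y} / wdegree E w x + w {x, y} / wdegree E w y) - 2)"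
proof -
  define b where "b = 1 - \<alpha>"
  define p where "p = w {x, y} / wdegree E w x"
  define q where "q = w {x, y} / wdegree E w y"
  define P where "P = lazy_walk E w \<alpha> x"
  define Q where "Q = lazy_walk E w \<alpha> y"
  have yx: "y \<in> nbrs E x" "x \<in> nbrs E y" using xy by (auto simp: nbrs_def insert_commute)
  have xny: "x \<noteq> y" using irr xy by auto
  have xx: "x \<notin> nbrs E x" "y \<notin> nbrs E y" using irr by (auto simp: nbrs_def)
  have b: "0 < b" "b < 1 / 2" using a by (auto simp: b_def)
  have D: "0 < wdegree E w x" "0 < wdegree E w y" unfolding wdegree_def
    by (rule sum_pos; use fin yx pos in \<open>auto simp: nbrs_def\<close>)+
  have pP: "pmf P z = (if z = x then \<alpha>
     else if z \<in> nbrs E x then b * w {x, z} / wdegree E w x else 0)" for z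
    unfolding P_def b_def by (rule pmf_lazy_walk) (use a fin yx irr pos in auto)
  have pQ: "pmf Q z = (if z = y then \<alpha>
     else if z \<in> nbrs E y then b * w {y, z} / wdegree E w y else 0)" for z
    unfolding Q_def b_def by (rule pmf_lazy_walk) (use a fin yx irr pos in auto)
  have sP: "set_pmf P \<subseteq> insert x (nbrs E x)" and sQ: "set_pmf Q \<subseteq> insert y (nbrs E y)"
    by (auto simp: set_pmf_iff pP pQ split: if_splits)
  have fPQ: "finite (set_pmf P)" "finite (set_pmf Q)" using sP sQ fin by (auto intro: finite_subset)
  have w_le: "w {x, z} \<le> wdegree E w x" if "z \<in> nbrs E x" for z
    unfolding wdegree_def using member_le_sum[of z "nbrs E x" "\<lambda>z. w {x, z}"] that fin pos
    by (force simp: nbrs_def less_imp_le)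
  have w_le': "w {y, z} \<le> wdegree E w y" if "z \<in> nbrs E y" for z
    unfolding wdegree_def using member_le_sum[of z "nbrs E y" "\<lambda>z. w {y, z}"] that fin pos
    by (force simp: nbrs_def less_imp_le)
  have p: "0 < p" "p \<le> 1" and q: "0 < q" "q \<le> 1"
    using D w_le[OF yx(1)] w_le'[OF yx(2)] pos[OF xy]
    by (auto simp: p_def q_def insert_commute)
  have ab: "b * p < \<alpha>" "b * q < \<alpha>"
    using p q b mult_left_le[of p b] mult_left_le[of q b] unfolding b_def by linarith+
  have Py: "pmf P y = b * p" and Px: "pmf P x = \<alpha>" and Qx: "pmf Q x = b * q" and Qy: "pmf Q y = \<alpha>"
    using yx xny by (auto simp: pP pQ p_def q_def insert_commute)
  \<comment> \<open>The pointwise minimum of \<open>P\<close> and \<open>Q\<close> at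
    \<open>x\<close> and at \<open>y\<close>. Since \<alpha> > 1/2, the lazy mass \<alpha> exceeds
    \<open>b * p\<close> and \<open>b * q\<close>, so the minimum is what arrives from the other
    endpoint.\<close>
  define c where "c = (\<lambda>z. if z = x then b * q else if z = y then b * p else 0)"
  have c: "0 \<le> c z" "c z \<le> pmf P z" "c z \<le> pmf Q z" for z
    using b p q ab Py Px Qx Qy by (auto simp: c_def)
  obtain \<pi> where \<pi>: "\<pi> \<in> couplings P Q" and supp: "\<And>u v. (u, v) \<in> set_pmf \<pi> \<Longrightarrow>
           u = v \<and> 0 < c u \<or> c u < pmf P u \<and> c v < pmf Q v"
    using coupling_with_common_part[OF fPQ c] by blast
  define d where "d = (\<lambda>u v. real (graph_dist E u v))"
  \<comment> \<open>The walks follow the path through the edge \<open>xy\<close>. Only for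
    \<open>u = y\<close> and \<open>v = x\<close> does \<open>f\<close> decrease; there a walk is
    still supplied, so that the distance is attained.\<close>
  have walk: "\<exists>n. (u, v) \<in> adj_rel E ^^ n \<and> (real n = f v - f u \<or> f v < f u)"
    if "u \<in> insert x (nbrs E x)" "v \<in> insert y (nbrs E y)" for u v
  proof -
    let ?A = "adj_rel E"
    have e: "(x, y) \<in> ?A" "(y, x) \<in> ?A" using xy by (auto simp: adj_rel_def insert_commute)
    have eu: "(u, x) \<in> ?A" if "u \<noteq> x" using that \<open>u \<in> _\<close> by (auto simp: nbrs_def adj_rel_def insert_commute)
    have ev: "(y, v) \<in> ?A" if "v \<noteq> y" using that \<open>v \<in> _\<close> by (auto simp: nbrs_def adj_rel_def)
    consider "u = x" | "u = y" | "u \<noteq> x" "u \<noteq> y" by blast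
    then show ?thesis
    proof cases
      case 1
      consider "v = x" | "v = y" | "v \<noteq> x" "v \<noteq> y" by blast
      then show ?thesis
      proof cases
        case 1 then show ?thesis using \<open>u = x\<close> by (intro exI[of _ 0]) auto
      next
        case 2 then show ?thesis using \<open>u = x\<close> e f by (intro exI[of _ 1]) auto
      next
        case 3 then show ?thesis using \<open>u = x\<close> e ev f(1) f(4)[of v] that
          by (intro exI[of _ 2]) (auto intro: relpow_2I)
      qed
    next
      case 2
      consider "v = x" | "v = y" | "v \<noteq> x" "v \<noteq> y" by blast
      then show ?thesis
      proof cases
        case 1 then show ?thesis using \<open>u = y\<close> e f by (intro exI[of _ 1]) auto
      next
        case 2 then show ?thesis using \<open>u = y\<close> by (intro exI[of _ 0]) auto
      next
        case 3 then show ?thesis using \<open>u = y\<close> ev f(2) f(4)[of v] that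
          by (intro exI[of _ 1]) auto
      qed
    next
      case 3
      then have fu: "f u = -1" using f(3)[of u] that by auto
      consider "v = x" | "v = y" | "v \<noteq> x" "v \<noteq> y" by blast
      then show ?thesis
      proof cases
        case 1 then show ?thesis using 3 eu f fu by (intro exI[of _ 1]) auto
      next
        case 2 then show ?thesis using 3 eu e f fu by (intro exI[of _ 2]) (auto intro: relpow_2I)
      next
        case 3 then show ?thesis using eu e ev \<open>u \<noteq> x\<close> fu f(4)[of v] that
          by (intro exI[of _ 3]) (auto intro: relpow_3I)
      qed
    qed
  qed
  have tight: "d u v = f v - f u"
    if uv: "u \<in> insert x (nbrs E x)" "v \<in> insert y (nbrs E y)" and le: "f u \<le> f v" for u v
  proof -
    obtain n where n: "(u, v) \<in> adj_rel E ^^ n" "real n = f v - f u" using walk[OF uv] le by auto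
    show ?thesis using graph_dist_le[OF n(1)] potential_le_graph_dist[where f = f, OF lip n(1)] n(2)
      by (simp add: d_def)
  qed
  have W: "wasserstein1 d P Q =
    ennreal (measure_pmf.expectation Q f - measure_pmf.expectation P f)"
  proof (rule wasserstein1_eq_potential[OF fPQ _ _ \<pi>])
    show "0 \<le> d u v" for u v by (simp add: d_def)
    show "f v - f u \<le> d u v" if "u \<in> set_pmf P" "v \<in> set_pmf Q" for u v
      using walk[of u v] that sP sQ potential_le_graph_dist[where f = f, OF lip]
      unfolding d_def by blast
    show "d u v = f v - f u" if uv: "(u, v) \<in> set_pmf \<pi>" for u v
    proof (rule tight)
      have "u \<in> set_pmf P" "v \<in> set_pmf Q"
        using \<pi> uv unfolding couplings_def by force+
      then show u: "u \<in> insert x (nbrs E x)" and v: "v \<in> insert y (nbrs E y)" using sP sQ by auto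
      show "f u \<le> f v"
      proof (cases "u = v")
        case False
        then have "c u < pmf P u" "c v < pmf Q v" using supp[OF uv] by auto
        \<comment> \<open>\<open>P\<close> has nothing left at \<open>y\<close> and \<open>Q\<close>
          nothing at \<open>x\<close>, which excludes the only pair along which \<open>f\<close>
          decreases.\<close>
        then have "u \<noteq> y" "v \<noteq> x" using xny Py Qx by (auto simp: c_def)
        then show ?thesis using u v f by (cases "u = x"; cases "v = y") auto
      qed simp
    qed
  qed
  have EP: "measure_pmf.expectation P f = b * p - b * (1 - p)"
  proof -
    have "measure_pmf.expectation P f = (\<Sum>z\<in>insert x (nbrs E x). pmf P z * f z)"
      by (subst integral_measure_pmf_real[of "insert x (nbrs E x)"])
        (use fin sP in \<open>auto simp: mult.commute\<close>)
    also have "\<dots> = (\<Sum>z\<in>nbrs E x. pmf P z * f z)" using fin f xx by simp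
    also have "\<dots> = b * p + (\<Sum>z\<in>nbrs E x - {y}. pmf P z * f z)"
      using fin yx f Py by (simp add: sum.remove[of _ y])
    also have "(\<Sum>z\<in>nbrs E x - {y}. pmf P z * f z) =
        (\<Sum>z\<in>nbrs E x - {y}. - (b * w {x, z} / wdegree E w x))"
      by (rule sum.cong) (use f xx in \<open>auto simp: pP\<close>)
    also have "\<dots> = - (b / wdegree E w x) * (\<Sum>z\<in>nbrs E x - {y}. w {x, z})"
      by (simp add: sum_distrib_left sum_negf)
    also have "(\<Sum>z\<in>nbrs E x - {y}. w {x, z}) = wdegree E w x - w {x, y}"
      using fin yx by (simp add: wdegree_def sum.remove[of _ y])
    finally show ?thesis using D by (simp add: p_def field_simps)
  qed
  have EQ: "measure_pmf.expectation Q f = \<alpha> + 2 * (b * (1 - q))"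
  proof -
    have "measure_pmf.expectation Q f = (\<Sum>z\<in>insert y (nbrs E y). pmf Q z * f z)"
      by (subst integral_measure_pmf_real[of "insert y (nbrs E y)"])
        (use fin sQ in \<open>auto simp: mult.commute\<close>)
    also have "\<dots> = \<alpha> + (\<Sum>z\<in>nbrs E y. pmf Q z * f z)" using fin f xx Qy by simp
    also have "(\<Sum>z\<in>nbrs E y. pmf Q z * f z) = (\<Sum>z\<in>nbrs E y - {x}. pmf Q z * f z)"
      using fin yx f by (simp add: sum.remove[of _ x])
    also have "\<dots> = (\<Sum>z\<in>nbrs E y - {x}. 2 * (b * w {y, z} / wdegree E w y))"
      by (rule sum.cong) (use f xx in \<open>auto simp: pQ\<close>)
    also have "\<dots> = 2 * (b / wdegree E w y) * (\<Sum>z\<in>nbrs E y - {x}. w {y, z})"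
      by (simp add: sum_distrib_left mult.assoc)
    also have "(\<Sum>z\<in>nbrs E y - {x}. w {y, z}) = wdegree E w y - w {x, y}"
      using fin yx by (simp add: wdegree_def sum.remove[of _ x] insert_commute)
    finally show ?thesis using D by (simp add: q_def field_simps)
  qed
  have diff: "measure_pmf.expectation Q f - measure_pmf.expectation P f =
      1 + b * (2 - 2 * p - 2 * q)"
    unfolding EP EQ b_def by (simp add: algebra_simps)
  \<comment> \<open>\<open>enn2real\<close> inverts \<open>ennreal\<close> only on nonnegative
    reals; \<open>b < 1 / 2\<close> provides the sign.\<close>
  have "b * (2 - 2 * p - 2 * q) \<ge> b * (-2)"
    using b p q by (intro mult_left_mono) auto
  then have "0 \<le> 1 + b * (2 - 2 * p - 2 * q)" using b by linarith
  then have "kappa E w \<alpha> x y = - b * (2 - 2 * p - 2 * q)"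
    unfolding kappa_def P_def[symmetric] Q_def[symmetric] d_def[symmetric] W diff by simp
  then show ?thesis unfolding p_def[symmetric] q_def[symmetric] b_def[symmetric] by (simp add: algebra_simps)
qed

text \<open>For \<alpha> close to 1 the curvature \<open>kappa\<close> is exactly linear in
  \<open>1 - \<alpha>\<close>, so the quotient is eventually constant.\<close>

lemma kappa_LLY_eq:
  fixes f :: "'a \<Rightarrow> real"
  assumes lip: "\<And>u v. {u, v} \<in> E \<Longrightarrow> \<bar>f u - f v\<bar> \<le> 1"
    and irr: "\<And>u. {u, u} \<notin> E" and xy: "{x, y} \<in> E"
    and fin: "finite (nbrs E x)" "finite (nbrs E y)"
    and pos: "\<And>e. e \<in> E \<Longrightarrow> 0 < w e"
    and f: "f x = 0" "f y = 1" "\<And>z. z \<in> nbrs E x \<Longrightarrow> z \<noteq> y \<Longrightarrow> f z = -1"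
      "\<And>z. z \<in> nbrs E y \<Longrightarrow> z \<noteq> x \<Longrightarrow> f z = 2"
  shows "kappa_LLY E w x y = 2 * (w {x, y} / wdegree E w x + w {x, y} / wdegree E w y) - 2"
proof -
  have "eventually (\<lambda>\<alpha>. \<alpha> \<in> {1/2<..<1}) (at_left (1::real))"
    by (rule eventually_at_leftI[of "1/2"]) auto
  then have "eventually (\<lambda>\<alpha>. kappa E w \<alpha> x y / (1 - \<alpha>) =
      2 * (w {x, y} / wdegree E w x + w {x, y} / wdegree E w y) - 2) (at_left 1)"
  proof (rule eventually_mono)
    fix \<alpha> :: real assume "\<alpha> \<in> {1/2<..<1}"
    then show "kappa E w \<alpha> x y / (1 - \<alpha>) =
      2 * (w {x, y} / wdegree E w x + w {x, y} / wdegree E w y) - 2"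
      by (subst kappa_eq[where f = f, OF lip irr xy fin pos f]) auto
  qed
  then show ?thesis unfolding kappa_LLY_def
    by (intro tendsto_Lim tendsto_eventually) auto
qed

section \<open>Trees oriented towards an end\<close>

text \<open>The invariant is that infinitely many points remain reachable; finite branching hands it
  on to some successor. As \<open>R\<close> may have cycles, injectivity of the path is left to each
  application.\<close>

lemma koenig_infinite_path:
  assumes "infinite (R\<^sup>* `` {x})" and "\<And>y. (x, y) \<in> R\<^sup>* \<Longrightarrow> finite (R `` {y})"
  obtains s where "s 0 = x" "\<And>n. (s n, s (Suc n)) \<in> R"
proof -
  define Q where "Q = (\<lambda>(n :: nat) y. (x, y) \<in> R\<^sup>* \<and> infinite (R\<^sup>* `` {y}) \<and> (n = 0 \<longrightarrow> y = x))"
  have "\<exists>z. Q (Suc n) z \<and> (y, z) \<in> R" if "Q n y" for n y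
  proof -
    have y: "(x, y) \<in> R\<^sup>*" "infinite (R\<^sup>* `` {y})" using that by (auto simp: Q_def)
    have "R\<^sup>* `` {y} = insert y (\<Union>z\<in>R `` {y}. R\<^sup>* `` {z})"
      by (auto intro: converse_rtrancl_into_rtrancl elim: converse_rtranclE)
    then obtain z where "z \<in> R `` {y}" "infinite (R\<^sup>* `` {z})"
      using y assms(2)[OF y(1)] by auto
    then show ?thesis using y(1) by (auto simp: Q_def intro: rtrancl_into_rtrancl)
  qed
  moreover have "Q 0 x" using assms(1) by (simp add: Q_def)
  ultimately obtain s where "\<And>n. Q n (s n) \<and> (s n, s (Suc n)) \<in> R"
    using dependent_nat_choice[of Q "\<lambda>_ y z. (y, z) \<in> R"] by blast
  then show thesis using that[of s] by (auto simp: Q_def)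
qed

section \<open>Paths, cycles and rooted trees\<close>

lemma rtrancl_adj_distinct_walk:
  assumes "(x, y) \<in> (adj_rel E)\<^sup>*"
  obtains xs where "xs \<noteq> []" "hd xs = x" "last xs = y" "distinct xs"
    "successively (\<lambda>u v. {u, v} \<in> E) xs"
  using assms
proof (induction arbitrary: thesis rule: rtrancl_induct)
  case base
  show ?case by (rule base[of "[x]"]) auto
next
  case (step y z)
  obtain xs where xs: "xs \<noteq> []" "hd xs = x" "last xs = y" "distinct xs"
    "successively (\<lambda>u v. {u, v} \<in> E) xs" by (rule step.IH)
  show ?case
  proof (cases "z \<in> set xs")
    case True
    then obtain as bs where s: "xs = as @ z # bs" by (auto dest: split_list)
    show ?thesis
      by (rule step.prems[of "as @ [z]"])
        (use xs s in \<open>auto simp: hd_append successively_append_iff split: if_splits\<close>)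
  next
    case False
    show ?thesis
      by (rule step.prems[of "xs @ [z]"])
        (use xs step.hyps(2) False in \<open>auto simp: successively_append_iff adj_rel_def\<close>)
  qed
qed

text \<open>A path from \<open>a\<close> to \<open>b\<close> avoiding the edge \<open>ab\<close> is
  closed up by that edge. It has at least three vertices, since a path on two would be the removed
  edge.\<close>

lemma cycle_through_edge:
  assumes "{a, b} \<in> E" "a \<noteq> b" "(a, b) \<in> (adj_rel (E - {{a, b}}))\<^sup>*"
  shows "\<exists>xs. is_cycle E xs"
proof -
  obtain xs where xs: "xs \<noteq> []" "hd xs = a" "last xs = b" "distinct xs"
    "successively (\<lambda>u v. {u, v} \<in> E - {{a, b}}) xs"
    by (rule rtrancl_adj_distinct_walk[OF assms(3)])
  have "length xs \<ge> 3"
  proof (rule ccontr)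
    assume "\<not> length xs \<ge> 3"
    moreover obtain x ys where "xs = x # ys" using xs(1) by (cases xs) auto
    ultimately show False using xs assms(2) by (cases ys; cases "tl ys") auto
  qed
  moreover have "successively (\<lambda>u v. {u, v} \<in> E) xs"
    using xs(5) by (rule successively_mono) auto
  ultimately show ?thesis using xs assms(1) unfolding is_cycle_def
    by (auto simp: insert_commute)
qed

text \<open>The parent is a neighbour closer to \<open>v0\<close>, and \<open>d\<close> serves as
  measure for inductions. An edge that is not a parent edge would lie on a cycle: parent edges alone
  lead both of its ends to \<open>v0\<close>.\<close>

lemma tree_parent_function:
  assumes T: "is_tree V E" and v0: "v0 \<in> V"
  obtains P and d :: "'a \<Rightarrow> nat"
  where "\<And>x. x \<in> V \<Longrightarrow> x \<noteq> v0 \<Longrightarrow> {x, P x} \<in> E \<and> d (P x) < d x"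
    and "\<And>x y. {x, y} \<in> E \<Longrightarrow> x \<noteq> v0 \<and> P x = y \<or> y \<noteq> v0 \<and> P y = x"
proof -
  have simple: "simple_graph V E" and conn: "\<And>x. x \<in> V \<Longrightarrow> (v0, x) \<in> (adj_rel E)\<^sup>*"
    and acyc: "\<nexists>xs. is_cycle E xs"
    using T v0 by (auto simp: is_tree_def connected_graph_def)
  have V: "a \<in> V" "b \<in> V" "a \<noteq> b" if "{a, b} \<in> E" for a b
    using simple that by (auto simp: simple_graph_def card_2_iff)
  define d where "d = graph_dist E v0"
  have "\<exists>y. {x, y} \<in> E \<and> d y < d x" if "x \<in> V" "x \<noteq> v0" for x
  proof -
    obtain n where "(v0, x) \<in> adj_rel E ^^ n" using conn[OF \<open>x \<in> V\<close>] by (auto simp: rtrancl_power)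
    then have w: "(v0, x) \<in> adj_rel E ^^ d x" unfolding d_def graph_dist_def by (rule LeastI)
    obtain m where m: "d x = Suc m" using w \<open>x \<noteq> v0\<close> by (cases "d x") auto
    then obtain y where y: "(v0, y) \<in> adj_rel E ^^ m" "(y, x) \<in> adj_rel E" using w by auto
    have "d y \<le> m" unfolding d_def using y(1) by (rule graph_dist_le)
    then show ?thesis using y(2) m by (auto simp: adj_rel_def insert_commute intro!: exI[of _ y])
  qed
  then obtain P where P: "\<And>x. x \<in> V \<Longrightarrow> x \<noteq> v0 \<Longrightarrow> {x, P x} \<in> E \<and> d (P x) < d x" by metis
  show thesis
  proof (rule that[OF P])
    fix a b assume e: "{a, b} \<in> E"
    show "a \<noteq> v0 \<and> P a = b \<or> b \<noteq> v0 \<and> P b = a"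
    proof (rule ccontr)
      assume n: "\<not> ?thesis"
      let ?A = "adj_rel (E - {{a, b}})"
      have "(x, v0) \<in> ?A\<^sup>*" if "x \<in> V" for x
        using that
      proof (induction "d x" arbitrary: x rule: less_induct)
        case less
        show ?case
        proof (cases "x = v0")
          case False
          then have p: "{x, P x} \<in> E" "d (P x) < d x" using P less.prems by auto
          then have "{x, P x} \<noteq> {a, b}" using n False by (auto simp: doubleton_eq_iff)
          then have "(x, P x) \<in> ?A" using p by (simp add: adj_rel_def)
          moreover have "(P x, v0) \<in> ?A\<^sup>*" using less.hyps[OF p(2)] V(2)[OF p(1)] .
          ultimately show ?thesis by (rule converse_rtrancl_into_rtrancl)
        qed simp
      qed
      moreover have "sym ?A" by (auto simp: sym_def adj_rel_def insert_commute)
      ultimately have "(a, b) \<in> ?A\<^sup>*" using V[OF e]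
        by (meson rtrancl_trans sym_rtrancl symD)
      then show False using cycle_through_edge[OF e V(3)[OF e]] acyc by blast
    qed
  qed
qed

text \<open>Koenig's lemma applied to the child relation; the measure \<open>d\<close> increases
  strictly along the resulting path, which makes it injective.\<close>

lemma infinite_tree_has_ray:
  assumes T: "is_tree V E" and fin: "locally_finite V E" and inf: "infinite V"
  obtains r where "is_ray E r"
proof -
  obtain v0 where v0: "v0 \<in> V" using inf by (metis ex_in_conv finite.emptyI)
  obtain P and d :: "'a \<Rightarrow> nat"
    where P: "\<And>x. x \<in> V \<Longrightarrow> x \<noteq> v0 \<Longrightarrow> {x, P x} \<in> E \<and> d (P x) < d x"
    and eP: "\<And>x y. {x, y} \<in> E \<Longrightarrow> x \<noteq> v0 \<and> P x = y \<or> y \<noteq> v0 \<and> P y = x"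
    by (rule tree_parent_function[OF T v0]) blast
  have V: "a \<in> V" "b \<in> V" if "{a, b} \<in> E" for a b
    using T that by (auto simp: is_tree_def connected_graph_def simple_graph_def)
  define R where "R = {(x, c). c \<in> V \<and> c \<noteq> v0 \<and> P c = x}"
  have "(v0, x) \<in> R\<^sup>*" if "x \<in> V" for x
    using that
  proof (induction "d x" arbitrary: x rule: less_induct)
    case less
    show ?case
    proof (cases "x = v0")
      case False
      then have "(v0, P x) \<in> R\<^sup>*" "(P x, x) \<in> R"
        using less P[OF less.prems] V by (auto simp: R_def)
      then show ?thesis by (rule rtrancl_into_rtrancl)
    qed simp
  qed
  then have "V \<subseteq> R\<^sup>* `` {v0}" by auto
  then have "infinite (R\<^sup>* `` {v0})" using inf finite_subset by blast
  moreover have "finite (R `` {y})" for y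
  proof (cases "y \<in> V")
    case True
    have "R `` {y} \<subseteq> nbrs E y" using P by (force simp: R_def nbrs_def insert_commute)
    then show ?thesis using fin True by (meson finite_subset locally_finite_def)
  next
    case False
    then have "R `` {y} = {}" using P V by (fastforce simp: R_def)
    then show ?thesis by simp
  qed
  ultimately obtain s where s: "\<And>n. (s n, s (Suc n)) \<in> R"
    using koenig_infinite_path[of R v0] by blast
  have "d (s n) < d (s (Suc n))" for n using s[of n] P[of "s (Suc n)"] by (auto simp: R_def)
  then have "strict_mono (d \<circ> s)" by (simp add: strict_mono_Suc_iff)
  then have "inj s" by (metis strict_mono_imp_inj_on inj_on_imageI2)
  moreover have "{s n, s (Suc n)} \<in> E" for n
    using s[of n] P[of "s (Suc n)"] by (auto simp: R_def insert_commute)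
  ultimately show thesis using that[of s] by (simp add: is_ray_def)
qed

text \<open>Every vertex is given its neighbour \<open>\<pi> x\<close> in the direction of the end of the ray \<open>r\<close>.\<close>

locale ray_oriented_tree =
  fixes V :: "'a set" and E :: "'a set set" and r :: "nat \<Rightarrow> 'a" and \<pi> :: "'a \<Rightarrow> 'a"
  assumes tree: "is_tree V E"
    and finite_nbrs: "x \<in> V \<Longrightarrow> finite (nbrs E x)"
    and inj_r: "inj r" and r_in_V: "r n \<in> V"
    and pi_edge: "x \<in> V \<Longrightarrow> {x, \<pi> x} \<in> E"
    and edge_pi: "{x, y} \<in> E \<Longrightarrow> \<pi> x = y \<or> \<pi> y = x"
    and pi_r: "\<pi> (r n) = r (Suc n)"
    and reaches_ray: "x \<in> V \<Longrightarrow> \<exists>k n. (\<pi> ^^ k) x = r n"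

text \<open>Root the tree at \<open>r 0\<close> and reverse the parent pointers on the ray. Off the
  ray the pointers lead towards \<open>r 0\<close> and thus run into the ray, from where \<pi> goes
  outwards forever.\<close>

lemma ray_orientation:
  assumes T: "is_tree V E" and fin: "locally_finite V E" and r: "is_ray E r"
  obtains \<pi> where "ray_oriented_tree V E r \<pi>"
proof -
  have V: "a \<in> V" "b \<in> V" if "{a, b} \<in> E" for a b
    using T that by (auto simp: is_tree_def connected_graph_def simple_graph_def)
  have inj: "inj r" and re: "{r n, r (Suc n)} \<in> E" for n using r by (auto simp: is_ray_def)
  have rV: "r n \<in> V" for n using V re by blast
  obtain P and d :: "'a \<Rightarrow> nat"
    where P: "\<And>x. x \<in> V \<Longrightarrow> x \<noteq> r 0 \<Longrightarrow> {x, P x} \<in> E \<and> d (P x) < d x"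
    and eP: "\<And>x y. {x, y} \<in> E \<Longrightarrow> x \<noteq> r 0 \<and> P x = y \<or> y \<noteq> r 0 \<and> P y = x"
    by (rule tree_parent_function[OF T rV[of 0]]) blast
  have Pr: "P (r (Suc n)) = r n" for n
  proof (induction n)
    case 0
    then show ?case using eP[OF re[of 0]] by simp
  next
    case (Suc n)
    then show ?case using eP[OF re[of "Suc n"]] inj by (auto simp: inj_eq)
  qed
  define \<pi> where "\<pi> = (\<lambda>x. if x \<in> range r then r (Suc (inv r x)) else P x)"
  have pi_r: "\<pi> (r n) = r (Suc n)" for n using inj by (simp add: \<pi>_def)
  have pi_P: "\<pi> x = P x" if "x \<notin> range r" for x using that by (simp add: \<pi>_def)
  have half: "\<pi> x = y \<or> \<pi> y = x" if "P x = y" "x \<noteq> r 0" for x y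
  proof (cases "x \<in> range r")
    case True
    then obtain n where "x = r (Suc n)" using \<open>x \<noteq> r 0\<close> by (metis not0_implies_Suc rangeE)
    then show ?thesis using that Pr pi_r by auto
  qed (use that pi_P in auto)
  have "ray_oriented_tree V E r \<pi>"
  proof
    show "finite (nbrs E x)" if "x \<in> V" for x using fin that by (simp add: locally_finite_def)
    show "{x, \<pi> x} \<in> E" if "x \<in> V" for x
      using that P[of x] re pi_r pi_P by (cases "x \<in> range r") force+
    show "\<pi> x = y \<or> \<pi> y = x" if "{x, y} \<in> E" for x y
      using eP[OF that] half by blast
    show "\<exists>k n. (\<pi> ^^ k) x = r n" if "x \<in> V" for x
      using that
    proof (induction "d x" arbitrary: x rule: less_induct)
      case less
      show ?case
      proof (cases "x \<in> range r")
        case True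
        then show ?thesis by (metis funpow_0 rangeE)
      next
        case False
        then have x: "x \<noteq> r 0" by auto
        obtain k n where "(\<pi> ^^ k) (P x) = r n" using less.hyps[of "P x"] P[OF less.prems x] V by blast
        then have "(\<pi> ^^ Suc k) x = r n" using pi_P[OF False] by (simp add: funpow_swap1)
        then show ?thesis by blast
      qed
    qed
  qed (use T inj rV pi_r in auto)
  then show thesis by (rule that)
qed

section \<open>Descendants, and weights seen from below\<close>

context ray_oriented_tree
begin

definition children :: "'a \<Rightarrow> 'a set" where "children x = {c \<in> V. \<pi> c = x}"

definition desc :: "'a \<Rightarrow> 'a set" where "desc x = {z \<in> V. \<exists>k. (\<pi> ^^ k) z = x}"

lemma edge_D: "{x, y} \<in> E \<Longrightarrow> x \<in> V \<and> y \<in> V \<and> x \<noteq> y"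
  using tree by (auto simp: is_tree_def connected_graph_def simple_graph_def card_2_iff)

lemma edge_cases:
  assumes "e \<in> E"
  obtains x where "x \<in> V" "e = {x, \<pi> x}"
proof -
  have "card e = 2"
    using tree assms by (simp add: is_tree_def connected_graph_def simple_graph_def)
  then obtain a b where "e = {a, b}" by (meson card_2_iff)
  then show thesis
    using that edge_pi[of a b] edge_D[of a b] assms by (metis insert_commute)
qed

lemma pi_in_V: "x \<in> V \<Longrightarrow> \<pi> x \<in> V"
  using pi_edge edge_D by blast

lemma funpow_pi_in_V: "x \<in> V \<Longrightarrow> (\<pi> ^^ k) x \<in> V"
  by (induction k) (auto intro: pi_in_V)

lemma funpow_pi_r: "(\<pi> ^^ k) (r n) = r (n + k)"
  by (induction k) (auto simp: pi_r)

text \<open>A period of \<pi> would persist along the orbit until the ray is reached, where \<pi>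
  shifts the index of an injective sequence.\<close>

lemma funpow_pi_neq:
  assumes "x \<in> V" "0 < k" shows "(\<pi> ^^ k) x \<noteq> x"
proof
  assume eq: "(\<pi> ^^ k) x = x"
  obtain j n where j: "(\<pi> ^^ j) x = r n" using reaches_ray[OF assms(1)] by blast
  have "r n = (\<pi> ^^ j) ((\<pi> ^^ k) x)" using eq j by simp
  also have "\<dots> = (\<pi> ^^ k) ((\<pi> ^^ j) x)" by (metis add.commute comp_apply funpow_add)
  also have "\<dots> = r (n + k)" using j by (simp add: funpow_pi_r)
  finally show False using inj_r assms(2) by (simp add: inj_eq)
qed

lemma pi_pi_neq: "x \<in> V \<Longrightarrow> \<pi> (\<pi> x) \<noteq> x"
  using funpow_pi_neq[of x 2] by (simp add: numeral_2_eq_2)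

lemma nbrs_eq: "x \<in> V \<Longrightarrow> nbrs E x = insert (\<pi> x) (children x)"
  using pi_edge edge_pi edge_D by (fastforce simp: nbrs_def children_def insert_commute)

lemma finite_children: "x \<in> V \<Longrightarrow> finite (children x)"
  using finite_nbrs[of x] nbrs_eq[of x] by simp

lemma pi_notin_children: "x \<in> V \<Longrightarrow> \<pi> x \<notin> children x"
  using pi_pi_neq by (auto simp: children_def)

lemma degree_eq: "x \<in> V \<Longrightarrow> degree E x = Suc (card (children x))"
  by (simp add: degree_def nbrs_eq finite_children pi_notin_children)

lemma desc_refl: "x \<in> V \<Longrightarrow> x \<in> desc x"
  by (auto simp: desc_def intro: exI[of _ 0])

text \<open>Equivalently, the edge above \<open>x\<close> is the only one that leaves
  \<open>desc x\<close>.\<close>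

lemma desc_pi_iff: "z \<in> V \<Longrightarrow> z \<noteq> x \<Longrightarrow> \<pi> z \<in> desc x \<longleftrightarrow> z \<in> desc x"
proof
  assume z: "z \<in> V" "z \<noteq> x"
  show "z \<in> desc x" if "\<pi> z \<in> desc x"
  proof -
    obtain k where "(\<pi> ^^ k) (\<pi> z) = x" using \<open>\<pi> z \<in> desc x\<close> by (auto simp: desc_def)
    then have "(\<pi> ^^ Suc k) z = x" by (simp add: funpow_swap1)
    then show ?thesis using z unfolding desc_def by blast
  qed
  show "\<pi> z \<in> desc x" if "z \<in> desc x"
  proof -
    obtain k where k: "(\<pi> ^^ k) z = x" using \<open>z \<in> desc x\<close> by (auto simp: desc_def)
    with z obtain j where "k = Suc j" by (cases k) auto
    then have "(\<pi> ^^ j) (\<pi> z) = x" using k by (simp add: funpow_swap1)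
    then show ?thesis using z pi_in_V unfolding desc_def by blast
  qed
qed

lemma pi_notin_desc: "x \<in> V \<Longrightarrow> \<pi> x \<notin> desc x"
proof
  assume x: "x \<in> V" and "\<pi> x \<in> desc x"
  then obtain k where "(\<pi> ^^ k) (\<pi> x) = x" by (auto simp: desc_def)
  then have "(\<pi> ^^ Suc k) x = x" by (simp add: funpow_swap1)
  then show False using funpow_pi_neq[OF x, of "Suc k"] by simp
qed

text \<open>Each edge is \<open>{x, \<pi> x}\<close> for exactly one vertex \<open>x\<close>, so
  edge weights can be treated as functions of vertices.\<close>

definition up :: "('a set \<Rightarrow> real) \<Rightarrow> 'a \<Rightarrow> real" where "up w x = w {x, \<pi> x}"

definition down :: "('a set \<Rightarrow> real) \<Rightarrow> 'a \<Rightarrow> real" where "down w x = sum (up w) (children x)"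

lemma wdegree_eq: "x \<in> V \<Longrightarrow> wdegree E w x = up w x + down w x"
proof -
  assume x: "x \<in> V"
  have "(\<Sum>c\<in>children x. w {x, c}) = down w x"
    unfolding down_def by (rule sum.cong) (auto simp: children_def up_def insert_commute)
  then show ?thesis using x
    by (simp add: wdegree_def nbrs_eq finite_children pi_notin_children up_def)
qed

lemma kappa_LLY_pi:
  assumes x: "x \<in> V" and pos: "\<And>e. e \<in> E \<Longrightarrow> 0 < w e"
  shows "kappa_LLY E w x (\<pi> x) =
      2 * (up w x / wdegree E w x + up w x / wdegree E w (\<pi> x)) - 2"
    and "kappa_LLY E w (\<pi> x) x =
      2 * (up w x / wdegree E w x + up w x / wdegree E w (\<pi> x)) - 2"
proof -
  \<comment> \<open>A signed distance across the edge, cut off at -1 and 2: the formula reads it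
    only on the two neighbourhoods, and cutting off preserves the Lipschitz bound.\<close>
  define f :: "'a \<Rightarrow> real" where
    "f z = (if z = x then 0 else if z \<in> desc x then - 1 else if z = \<pi> x then 1 else 2)" for z
  have fpx: "f (\<pi> x) = 1" using pi_notin_desc[OF x] edge_D[OF pi_edge[OF x]] by (auto simp: f_def)
  have half: "\<bar>f u - f (\<pi> u)\<bar> \<le> 1" if "u \<in> V" for u
  proof (cases "u = x")
    case True
    then show ?thesis using fpx by (simp add: f_def)
  next
    case False
    then show ?thesis using desc_pi_iff[OF that False] pi_pi_neq[OF x] desc_refl[OF x]
      by (auto simp: f_def)
  qed
  have lip: "\<bar>f u - f v\<bar> \<le> 1" if "{u, v} \<in> E" for u v
    using edge_pi[OF that] half edge_D[OF that] by (auto simp: abs_minus_commute)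
  have irr: "{u, u} \<notin> E" for u using edge_D by blast
  have f0: "f x = 0" by (simp add: f_def)
  have fx: "f z = - 1" if "z \<in> nbrs E x" "z \<noteq> \<pi> x" for z
  proof -
    have z: "z \<in> V" "\<pi> z = x" using that x by (auto simp: nbrs_eq children_def)
    then have "z \<noteq> x" using edge_D[OF pi_edge[OF z(1)]] by auto
    then show ?thesis using z desc_pi_iff[of z x] desc_refl[OF x] by (auto simp: f_def)
  qed
  have fy: "f z = 2" if "z \<in> nbrs E (\<pi> x)" "z \<noteq> x" for z
  proof (cases "z = \<pi> (\<pi> x)")
    case True
    have "\<pi> (\<pi> x) \<notin> desc x"
      using desc_pi_iff[of "\<pi> x" x] pi_notin_desc[OF x] pi_in_V[OF x] edge_D[OF pi_edge[OF x]] by auto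
    then show ?thesis using True pi_pi_neq[OF x] edge_D[OF pi_edge[OF pi_in_V[OF x]]]
      by (auto simp: f_def)
  next
    case False
    then have z: "z \<in> V" "\<pi> z = \<pi> x" using that x by (auto simp: nbrs_eq children_def pi_in_V)
    then have "z \<notin> desc x" using desc_pi_iff[of z x] that pi_notin_desc[OF x] by auto
    moreover have "z \<noteq> \<pi> x" using z edge_D[OF pi_edge[OF z(1)]] by auto
    ultimately show ?thesis using that by (auto simp: f_def)
  qed
  have e: "{x, \<pi> x} \<in> E" "{\<pi> x, x} \<in> E" using pi_edge[OF x] by (auto simp: insert_commute)
  have fin: "finite (nbrs E x)" "finite (nbrs E (\<pi> x))" using x by (auto intro: finite_nbrs pi_in_V)
  show "kappa_LLY E w x (\<pi> x) =
      2 * (up w x / wdegree E w x + up w x / wdegree E w (\<pi> x)) - 2"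
    unfolding up_def by (rule kappa_LLY_eq[where f = f]) (use lip irr e fin pos f0 fpx fx fy in auto)
  \<comment> \<open>Replacing \<open>f\<close> by \<open>1 - f\<close> exchanges the roles of the
    two endpoints.\<close>
  have "kappa_LLY E w (\<pi> x) x =
      2 * (w {\<pi> x, x} / wdegree E w (\<pi> x) + w {\<pi> x, x} / wdegree E w x) - 2"
    by (rule kappa_LLY_eq[where f = "\<lambda>z. 1 - f z"])
      (use lip irr e fin pos f0 fpx fx fy in \<open>auto simp: abs_minus_commute\<close>)
  then show "kappa_LLY E w (\<pi> x) x =
      2 * (up w x / wdegree E w x + up w x / wdegree E w (\<pi> x)) - 2"
    by (simp add: up_def insert_commute)
qed

lemma up_pos: "x \<in> V \<Longrightarrow> (\<And>e. e \<in> E \<Longrightarrow> 0 < w e) \<Longrightarrow> 0 < up w x"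
  using pi_edge by (auto simp: up_def)

lemma down_nonneg: "x \<in> V \<Longrightarrow> (\<And>e. e \<in> E \<Longrightarrow> 0 < w e) \<Longrightarrow> 0 \<le> down w x"
  unfolding down_def by (rule sum_nonneg) (auto simp: children_def intro: less_imp_le up_pos)

lemma admissible_iff:
  "admissible E w \<longleftrightarrow> (\<forall>e\<in>E. 0 < w e) \<and>
     (\<forall>x\<in>V. down w x * (wdegree E w (\<pi> x) - up w x) \<le> (up w x)\<^sup>2)"
proof (cases "\<forall>e\<in>E. 0 < w e")
  case True
  then have pos: "\<And>e. e \<in> E \<Longrightarrow> 0 < w e" by auto
  have nn: "0 \<le> kappa_LLY E w x (\<pi> x) \<longleftrightarrow>
      down w x * (wdegree E w (\<pi> x) - up w x) \<le> (up w x)\<^sup>2" if x: "x \<in> V" for x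
  proof -
    define A where "A = wdegree E w x"
    define B where "B = wdegree E w (\<pi> x)"
    define t where "t = up w x"
    have "0 < A" "0 < B" unfolding A_def B_def
      using up_pos[OF _ pos] down_nonneg[OF _ pos] x pi_in_V[OF x]
      by (simp_all add: wdegree_eq add_pos_nonneg)
    have "kappa_LLY E w x (\<pi> x) = 2 * (t / A + t / B) - 2"
      unfolding A_def B_def t_def by (rule kappa_LLY_pi(1)[OF x pos])
    then have "0 \<le> kappa_LLY E w x (\<pi> x) \<longleftrightarrow> 1 \<le> t / A + t / B" by auto
    also have "\<dots> \<longleftrightarrow> A * B \<le> t * B + t * A"
      using \<open>0 < A\<close> \<open>0 < B\<close> by (simp add: field_simps)
    also have "\<dots> \<longleftrightarrow> (A - t) * (B - t) \<le> t\<^sup>2"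
      by (simp add: algebra_simps power2_eq_square)
    also have "A - t = down w x" using x by (simp add: A_def t_def wdegree_eq)
    finally show ?thesis by (simp add: B_def t_def)
  qed
  have "(\<forall>x y. {x, y} \<in> E \<longrightarrow> 0 \<le> kappa_LLY E w x y) \<longleftrightarrow> (\<forall>x\<in>V. 0 \<le> kappa_LLY E w x (\<pi> x))"
  proof
    assume *: "\<forall>x\<in>V. 0 \<le> kappa_LLY E w x (\<pi> x)"
    show "\<forall>x y. {x, y} \<in> E \<longrightarrow> 0 \<le> kappa_LLY E w x y"
    proof (intro allI impI)
      fix x y assume e: "{x, y} \<in> E"
      show "0 \<le> kappa_LLY E w x y"
        using edge_pi[OF e] edge_D[OF e] * kappa_LLY_pi[OF _ pos] by auto
    qed
  qed (use pi_edge in auto)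
  then show ?thesis using nn True by (auto simp: admissible_def)
qed (auto simp: admissible_def)

end

section \<open>Bounded admissible weights\<close>

text \<open>Log-concavity means that the ratios of consecutive terms do not increase. If the first
  ratio were below 1, the sequence would decay geometrically and fall below
  \<open>m\<close>.\<close>

lemma log_concave_bounded_below_mono:
  fixes a :: "nat \<Rightarrow> real"
  assumes m: "0 < m" "\<And>i. m \<le> a i" and lc: "\<And>i. a i * a (i + 2) \<le> (a (i + 1))\<^sup>2"
  shows "a 0 \<le> a 1"
proof (rule ccontr)
  assume "\<not> a 0 \<le> a 1"
  then have less: "a 1 < a 0" by simp
  have pos: "0 < a i" for i using m(1) m(2)[of i] by linarith
  define \<rho> where "\<rho> = a 1 / a 0"
  have rho: "0 < \<rho>" "\<rho> < 1" using less pos by (auto simp: \<rho>_def)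
  have step: "a (Suc n) \<le> \<rho> * a n" for n
  proof (induction n)
    case 0
    then show ?case using pos[of 0] by (simp add: \<rho>_def)
  next
    case (Suc n)
    have "a n * a (Suc (Suc n)) \<le> a (Suc n) * a (Suc n)"
      using lc[of n] by (simp add: power2_eq_square)
    also have "\<dots> \<le> a (Suc n) * (\<rho> * a n)" using Suc pos by (intro mult_left_mono) (auto intro: less_imp_le)
    finally show ?case using pos[of n] by (simp add: mult.commute mult.left_commute)
  qed
  have geom: "a n \<le> \<rho> ^ n * a 0" for n
  proof (induction n)
    case (Suc n)
    then show ?case using order_trans[OF step[of n] mult_left_mono[OF Suc, of \<rho>]] rho by (simp add: mult.assoc)
  qed simp
  obtain n where "\<rho> ^ n < m / a 0" using real_arch_pow_inv[of "m / a 0" \<rho>] m(1) pos[of 0] rho by auto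
  then have "\<rho> ^ n * a 0 < m" using pos[of 0] by (simp add: field_simps)
  then show False using geom[of n] m(2)[of n] by linarith
qed

lemma finite_vimage_tail:
  fixes s :: "nat \<Rightarrow> 'a"
  assumes "inj s" "finite S"
  obtains N where "\<And>n. n \<ge> N \<Longrightarrow> s n \<notin> S"
proof -
  have "finite (s -` S)" using assms by (simp add: finite_vimageI)
  then obtain N where "\<forall>n\<in>s -` S. n < N" by (metis finite_nat_set_iff_bounded)
  then show thesis using that[of N] by (meson not_le vimageI2)
qed

section \<open>Monotonicity towards the end and the number of branch vertices\<close>

context ray_oriented_tree
begin

text \<open>The symmetric form of \<open>admissible_iff\<close>, for rays that may run with or
  against \<pi>.\<close>

lemma admissible_edge:
  assumes adm: "admissible E w" and e: "{x, y} \<in> E"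
  shows "(wdegree E w x - w {x, y}) * (wdegree E w y - w {x, y}) \<le> (w {x, y})\<^sup>2"
proof -
  have *: "(wdegree E w x - w {x, \<pi> x}) * (wdegree E w (\<pi> x) - w {x, \<pi> x}) \<le> (w {x, \<pi> x})\<^sup>2"
    if "x \<in> V" for x
    using adm that by (auto simp: admissible_iff wdegree_eq up_def)
  show ?thesis using edge_pi[OF e] *[of x] *[of y] edge_D[OF e]
    by (auto simp: insert_commute mult.commute)
qed

lemma two_weights_le_wdegree:
  assumes adm: "admissible E w" and e: "{x, y} \<in> E" "{x, z} \<in> E" "y \<noteq> z"
  shows "w {x, y} + w {x, z} \<le> wdegree E w x"
proof -
  have "(\<Sum>v\<in>{y, z}. w {x, v}) \<le> wdegree E w x" unfolding wdegree_def
    by (rule sum_mono2)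
      (use adm e edge_D[OF e(1)] finite_nbrs in \<open>auto simp: nbrs_def admissible_def less_imp_le\<close>)
  then show ?thesis using e(3) by simp
qed

text \<open>At either end of a ray edge, the rest of the weighted degree contains the adjacent ray
  edge, so the edge inequality implies log-concavity. Comparing the first two edges suffices because
  a ray may be started at any of its vertices.\<close>

lemma weights_mono_along_ray:
  assumes adm: "admissible E w" and m: "0 < m" "\<And>e. e \<in> E \<Longrightarrow> m \<le> w e"
    and s: "is_ray E s"
  shows "w {s 0, s 1} \<le> w {s 1, s 2}"
proof -
  have e: "{s n, s (Suc n)} \<in> E" and inj: "inj s" for n using s by (auto simp: is_ray_def)
  define a where "a i = w {s i, s (Suc i)}" for i
  have "a 0 \<le> a 1"
  proof (rule log_concave_bounded_below_mono[OF m(1)])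
    show ma: "m \<le> a i" for i using m e by (simp add: a_def)
    fix i
    have 1: "a (i + 1) + a i \<le> wdegree E w (s (Suc i))"
      using two_weights_le_wdegree[OF adm e[of "Suc i"], of "s i"] e[of i] inj
      by (simp add: a_def insert_commute inj_eq)
    have 2: "a (i + 1) + a (i + 2) \<le> wdegree E w (s (Suc (Suc i)))"
      using two_weights_le_wdegree[OF adm _ e[of "Suc (Suc i)"], of "s (Suc i)"] e[of "Suc i"] inj
      by (simp add: a_def insert_commute inj_eq)
    have "a i * a (i + 2) \<le> (wdegree E w (s (Suc i)) - a (i + 1)) * (wdegree E w (s (Suc (Suc i))) - a (i + 1))"
      using 1 2 ma[of i] ma[of "i + 2"] m(1) by (intro mult_mono) linarith+
    also have "\<dots> \<le> (a (i + 1))\<^sup>2" using admissible_edge[OF adm e[of "Suc i"]] by (simp add: a_def)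
    finally show "a i * a (i + 2) \<le> (a (i + 1))\<^sup>2" .
  qed
  then show ?thesis by (simp add: a_def numeral_2_eq_2)
qed

lemma pi_orbit_is_ray: "x \<in> V \<Longrightarrow> is_ray E (\<lambda>n. (\<pi> ^^ n) x)"
proof -
  assume x: "x \<in> V"
  have neq: "(\<pi> ^^ i) x \<noteq> (\<pi> ^^ j) x" if "i < j" for i j
  proof -
    have "(\<pi> ^^ (j - i)) ((\<pi> ^^ i) x) \<noteq> (\<pi> ^^ i) x"
      using funpow_pi_neq[OF funpow_pi_in_V[OF x, of i], of "j - i"] that by simp
    moreover have "(\<pi> ^^ (j - i)) ((\<pi> ^^ i) x) = (\<pi> ^^ j) x"
      using that by (metis comp_apply funpow_add le_add_diff_inverse2 less_imp_le)
    ultimately show ?thesis by simp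
  qed
  have "inj (\<lambda>n. (\<pi> ^^ n) x)" by (rule injI) (metis neq nat_neq_iff)
  then show ?thesis using pi_edge[OF funpow_pi_in_V[OF x]] by (simp add: is_ray_def)
qed

lemma up_mono:
  assumes "admissible E w" "0 < m" "\<And>e. e \<in> E \<Longrightarrow> m \<le> w e" "x \<in> V"
  shows "up w x \<le> up w (\<pi> x)"
  using weights_mono_along_ray[OF assms(1-3) pi_orbit_is_ray[OF assms(4)]]
  by (simp add: up_def numeral_2_eq_2)

text \<open>The second factor in \<open>admissible_iff\<close> is at least \<open>up w x\<close>:
  the vertex \<open>x\<close> is itself a child of \<open>\<pi> x\<close>, so what remains there is
  at least \<open>up w (\<pi> x)\<close>, and this is at least \<open>up w x\<close> by
  monotonicity. One factor \<open>up w x\<close> then cancels.\<close>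

lemma down_le_up:
  assumes adm: "admissible E w" and m: "0 < m" "\<And>e. e \<in> E \<Longrightarrow> m \<le> w e" and x: "x \<in> V"
  shows "down w x \<le> up w x"
proof -
  have pos: "\<And>e. e \<in> E \<Longrightarrow> 0 < w e" using adm by (simp add: admissible_def)
  have u: "0 < up w x" by (rule up_pos[OF x pos])
  have "up w x \<le> down w (\<pi> x)" unfolding down_def
    by (rule member_le_sum)
      (use x pi_in_V finite_children up_pos[where w = w, OF _ pos] in \<open>auto simp: children_def less_imp_le\<close>)
  then have "up w x \<le> wdegree E w (\<pi> x) - up w x"
    using up_mono[OF adm m x] x by (simp add: wdegree_eq pi_in_V)
  then have "down w x * up w x \<le> down w x * (wdegree E w (\<pi> x) - up w x)"
    using down_nonneg[OF x pos] by (rule mult_left_mono)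
  also have "\<dots> \<le> up w x * up w x" using adm x by (auto simp: admissible_iff power2_eq_square)
  finally show ?thesis using u by simp
qed

text \<open>A finite subtree below \<open>x\<close> has more leaves than branch vertices, and each leaf contributes at
  least \<open>m\<close> to the weight above \<open>x\<close>. Bounding the depth by \<open>n\<close> allows an induction although the
  set of all descendants may be infinite.\<close>

lemma card_branch_below:
  assumes adm: "admissible E w" and m: "0 < m" "\<And>e. e \<in> E \<Longrightarrow> m \<le> w e" and x: "x \<in> V"
  defines "B \<equiv> \<lambda>n x. {z \<in> branch_vertices V E. \<exists>k<n. (\<pi> ^^ k) z = x}"
  shows "finite (B n x) \<and> (real (card (B n x)) + 1) * m \<le> up w x"
  using x
proof (induction n arbitrary: x)
  case 0
  then show ?case using m(2) pi_edge by (simp add: B_def up_def)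
next
  case (Suc n)
  note x = Suc.prems
  define b where "b = (if 3 \<le> degree E x then {x} else {})"
  have cV: "c \<in> V" if "c \<in> children x" for c using that by (simp add: children_def)
  have fin: "finite (b \<union> (\<Union>c\<in>children x. B n c))"
    using Suc.IH cV finite_children[OF x] by (auto simp: b_def)
  have sub: "B (Suc n) x \<subseteq> b \<union> (\<Union>c\<in>children x. B n c)"
  proof
    fix z assume "z \<in> B (Suc n) x"
    then obtain k where z: "z \<in> branch_vertices V E" "k < Suc n" "(\<pi> ^^ k) z = x"
      by (auto simp: B_def)
    show "z \<in> b \<union> (\<Union>c\<in>children x. B n c)"
    proof (cases k)
      case 0
      then show ?thesis using z by (auto simp: b_def branch_vertices_def)
    next
      case (Suc j)
      then have "(\<pi> ^^ j) z \<in> children x" "z \<in> B n ((\<pi> ^^ j) z)"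
        using z by (auto simp: children_def B_def branch_vertices_def funpow_pi_in_V)
      then show ?thesis by blast
    qed
  qed
  have "card (B (Suc n) x) \<le> card b + (\<Sum>c\<in>children x. card (B n c))"
    using card_mono[OF fin sub] card_Un_le[of b "\<Union>c\<in>children x. B n c"]
      card_UN_le[OF finite_children[OF x], of "B n"] by linarith
  then have card: "real (card (B (Suc n) x)) \<le> card b + (\<Sum>c\<in>children x. real (card (B n c)))"
    by (simp flip: of_nat_sum of_nat_add)
  have "(real (card (B (Suc n) x)) + 1) * m \<le> up w x"
  proof (cases "children x = {}")
    case True
    then have "real (card (B (Suc n) x)) = 0" using card degree_eq[OF x] by (auto simp: b_def)
    then show ?thesis using m(2) pi_edge[OF x] by (simp add: up_def)
  next
    case False
    then have "0 < card (children x)" using finite_children[OF x] by (simp add: card_gt_0_iff)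
    \<comment> \<open>Every child contributes a spare \<open>+ 1\<close>. One of them is passed on
      upwards; a branch vertex has at least two children, so another one pays for \<open>x\<close>
      itself.\<close>
    then have b: "card b + 1 \<le> card (children x)" using degree_eq[OF x] by (auto simp: b_def)
    have "(real (card (B (Suc n) x)) + 1) * m
        \<le> ((\<Sum>c\<in>children x. real (card (B n c))) + card (children x)) * m"
      using card b m(1) by (intro mult_right_mono) linarith+
    also have "\<dots> = (\<Sum>c\<in>children x. (real (card (B n c)) + 1) * m)"
      by (simp only: sum_distrib_right[symmetric]) (simp add: sum.distrib)
    also have "\<dots> \<le> down w x" unfolding down_def using Suc.IH cV by (intro sum_mono) blast
    also have "\<dots> \<le> up w x" by (rule down_le_up[OF adm m x])
    finally show ?thesis .
  qed
  then show ?case using fin sub by (blast intro: finite_subset)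
qed

text \<open>Orbits that have reached the ray move along it, so finitely many of them pass through a
  common vertex far enough out.\<close>

lemma finite_set_reaches_common_vertex:
  "finite F \<Longrightarrow> F \<subseteq> V \<Longrightarrow> \<exists>n N. \<forall>z\<in>F. \<exists>k<n. (\<pi> ^^ k) z = r N"
proof (induction rule: finite_induct)
  case (insert z F)
  then obtain n N where F: "\<And>y. y \<in> F \<Longrightarrow> \<exists>k<n. (\<pi> ^^ k) y = r N" by auto
  obtain k l where z: "(\<pi> ^^ k) z = r l" using reaches_ray insert.prems by blast
  have "\<exists>j < n + l + k + N + 1. (\<pi> ^^ j) y = r (N + l)" if "y \<in> insert z F" for y
  proof (cases "y = z")
    case True
    have "(\<pi> ^^ (N + k)) z = r (N + l)" using z by (simp add: funpow_add funpow_pi_r add.commute)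
    then show ?thesis using True by (intro exI[of _ "N + k"]) auto
  next
    case False
    then obtain j where "j < n" "(\<pi> ^^ j) y = r N" using F \<open>y \<in> insert z F\<close> by auto
    then show ?thesis by (intro exI[of _ "l + j"]) (simp add: funpow_add funpow_pi_r)
  qed
  then show ?case by blast
qed simp

text \<open>Each finite set of branch vertices lies below a single ray vertex, whose upper edge
  bounds its size. The bound is uniform, so it also yields finiteness of the whole set.\<close>

lemma card_branch_vertices_le:
  assumes adm: "admissible E w" and m: "0 < m" "\<And>e. e \<in> E \<Longrightarrow> m \<le> w e"
    and M: "\<And>e. e \<in> E \<Longrightarrow> w e \<le> M"
  shows "finite (branch_vertices V E)" "real (card (branch_vertices V E)) \<le> M / m"
proof -
  have bound: "real (card F) \<le> M / m" if F: "F \<subseteq> branch_vertices V E" "finite F" for F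
  proof -
    have "F \<subseteq> V" using F by (auto simp: branch_vertices_def)
    then obtain n N where "\<forall>z\<in>F. \<exists>k<n. (\<pi> ^^ k) z = r N"
      using finite_set_reaches_common_vertex F(2) by blast
    then have sub: "F \<subseteq> {z \<in> branch_vertices V E. \<exists>k<n. (\<pi> ^^ k) z = r N}" (is "_ \<subseteq> ?B")
      using F by blast
    have B: "finite ?B" "(real (card ?B) + 1) * m \<le> up w (r N)"
      using card_branch_below[OF adm m r_in_V] by blast+
    have "real (card F) * m \<le> (real (card ?B) + 1) * m"
      using card_mono[OF B(1) sub] m(1) by (intro mult_right_mono) auto
    also have "\<dots> \<le> M" using B(2) M[OF pi_edge[OF r_in_V[of N]]] by (simp add: up_def)
    finally show ?thesis using m(1) by (simp add: field_simps)
  qed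
  show fin: "finite (branch_vertices V E)"
  proof (rule ccontr)
    assume "infinite (branch_vertices V E)"
    moreover obtain n :: nat where "M / m < n" using reals_Archimedean2 by blast
    ultimately obtain F where "finite F" "card F = n" "F \<subseteq> branch_vertices V E"
      using infinite_arbitrarily_large by blast
    then show False using bound[of F] \<open>M / m < n\<close> by simp
  qed
  show "real (card (branch_vertices V E)) \<le> M / m" using bound fin by blast
qed

section \<open>The shape of the tree: infinite and finite descendant sets\<close>

lemma infinite_desc_path:
  assumes x: "x \<in> V" and inf: "infinite (desc x)"
  obtains s where "s 0 = x" "\<And>n. s n \<in> V" "\<And>n. \<pi> (s (Suc n)) = s n"
proof -
  define R where "R = {(\<pi> c, c) | c. c \<in> V}"
  have "(x, z) \<in> R\<^sup>*" if "z \<in> V" "(\<pi> ^^ k) z = x" for k z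
    using that
  proof (induction k arbitrary: z)
    case (Suc k)
    then have "(x, \<pi> z) \<in> R\<^sup>*" by (simp add: pi_in_V funpow_swap1)
    then show ?case using Suc.prems(1) by (auto simp: R_def intro: rtrancl_into_rtrancl)
  qed simp
  then have "desc x \<subseteq> R\<^sup>* `` {x}" by (auto simp: desc_def)
  then have 1: "infinite (R\<^sup>* `` {x})" using inf finite_subset by blast
  have 2: "finite (R `` {y})" if "(x, y) \<in> R\<^sup>*" for y
  proof -
    have "y \<in> V" using that x by (induction rule: rtrancl_induct) (auto simp: R_def)
    moreover have "R `` {y} \<subseteq> children y" by (auto simp: R_def children_def)
    ultimately show ?thesis using finite_children finite_subset by blast
  qed
  obtain s where s: "s 0 = x" "\<And>n. (s n, s (Suc n)) \<in> R"
    using koenig_infinite_path[OF 1 2] by blast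
  have "s n \<in> V" for n
  proof (cases n)
    case (Suc j)
    then show ?thesis using s(2)[of j] by (auto simp: R_def)
  qed (use s x in auto)
  moreover have "\<pi> (s (Suc n)) = s n" for n using s(2)[of n] by (auto simp: R_def)
  ultimately show thesis using that s(1) by blast
qed

lemma double_ray_if_infinite_desc:
  assumes adm: "admissible E w" and m: "0 < m" "\<And>e. e \<in> E \<Longrightarrow> m \<le> w e"
    and x: "x \<in> V" and inf: "infinite (desc x)"
  shows "is_double_ray_graph V E"
proof -
  have pos: "\<And>e. e \<in> E \<Longrightarrow> 0 < w e" using adm by (simp add: admissible_def)
  obtain s where s: "s 0 = x" "\<And>n. s n \<in> V" "\<And>n. \<pi> (s (Suc n)) = s n"
    using infinite_desc_path[OF x inf] by blast
  define p where "p i = (if 0 \<le> i then (\<pi> ^^ nat i) x else s (nat (- i)))" for i :: int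
  have pV: "p i \<in> V" for i using funpow_pi_in_V[OF x] s by (simp add: p_def)
  have pi_p: "\<pi> (p i) = p (i + 1)" for i
  proof (cases "0 \<le> i")
    case True
    then show ?thesis by (simp add: p_def nat_add_distrib)
  next
    case False
    define n where "n = nat (- i - 1)"
    have n: "i = - 1 - int n" using False by (simp add: n_def)
    show ?thesis using s by (cases n) (auto simp: p_def n nat_add_distrib)
  qed
  have funpow_p: "(\<pi> ^^ k) (p i) = p (i + int k)" for k i
    by (induction k) (auto simp: pi_p ac_simps)
  have "p i \<noteq> p j" if "i < j" for i j
    using funpow_p[of "nat (j - i)" i] funpow_pi_neq[OF pV[of i], of "nat (j - i)"] that by auto
  then have inj: "inj p" by (metis injI linorder_neqE_linordered_idom)
  have up_eq: "up w (p (i + 1)) = up w (p i)" for i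
  proof (rule antisym)
    \<comment> \<open>The ray running against \<pi> gives the reverse inequality. It starts at
      \<open>i + 2\<close> so that its first two edges are those above \<open>p (i + 1)\<close> and
      above \<open>p i\<close>.\<close>
    have "is_ray E (\<lambda>n. p (i + 2 - int n))" unfolding is_ray_def
    proof (intro conjI allI)
      show "inj (\<lambda>n. p (i + 2 - int n))" by (rule injI) (use inj in \<open>simp add: inj_eq\<close>)
      show "{p (i + 2 - int n), p (i + 2 - int (Suc n))} \<in> E" for n
        using pi_edge[OF pV[of "i + 2 - int (Suc n)"]] pi_p[of "i + 2 - int (Suc n)"]
        by (simp add: insert_commute algebra_simps)
    qed
    from weights_mono_along_ray[OF adm m this] show "up w (p (i + 1)) \<le> up w (p i)"
      by (simp add: up_def pi_p insert_commute algebra_simps)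
    show "up w (p i) \<le> up w (p (i + 1))" using up_mono[OF adm m pV[of i]] by (simp add: pi_p)
  qed
  \<comment> \<open>The edges below \<open>p (i + 1)\<close> weigh at most \<open>up w (p i)\<close>
    in total, and the child \<open>p i\<close> already uses all of it.\<close>
  have children_p: "c = p i" if "c \<in> children (p (i + 1))" for c i
  proof (rule ccontr)
    assume "c \<noteq> p i"
    have "(\<Sum>v\<in>{c, p i}. up w v) \<le> down w (p (i + 1))" unfolding down_def
      by (rule sum_mono2)
        (use that pV pi_p finite_children up_pos[where w = w, OF _ pos] in \<open>auto simp: children_def less_imp_le\<close>)
    also have "\<dots> \<le> up w (p i)" using down_le_up[OF adm m pV[of "i + 1"]] up_eq[of i] by simp
    finally have "up w c \<le> 0" using \<open>c \<noteq> p i\<close> by simp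
    then show False using up_pos[of c w, OF _ pos] that by (simp add: children_def)
  qed
  have down_closed: "z \<in> range p" if "z \<in> V" "(\<pi> ^^ k) z \<in> range p" for z k
    using that(2)
  proof (induction k)
    case (Suc k)
    then obtain i where "\<pi> ((\<pi> ^^ k) z) = p (i - 1 + 1)" by auto
    then have "(\<pi> ^^ k) z = p (i - 1)"
      using children_p[of "(\<pi> ^^ k) z" "i - 1"] funpow_pi_in_V[OF that(1), of k]
      by (simp add: children_def)
    then show ?case using Suc.IH by simp
  qed simp
  \<comment> \<open>The orbits of any vertex and of \<open>p 0\<close> meet on \<open>r\<close>, and
    \<open>range p\<close> is closed under passing to children.\<close>
  have VR: "V = range p"
  proof
    show "V \<subseteq> range p"
    proof
      fix z assume z: "z \<in> V"
      obtain k n where k: "(\<pi> ^^ k) z = r n" using reaches_ray[OF z] by blast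
      obtain j l where j: "(\<pi> ^^ j) (p 0) = r l" using reaches_ray[OF pV] by blast
      have "(\<pi> ^^ (l + k)) z = r (n + l)" using k by (simp add: funpow_add funpow_pi_r)
      also have "\<dots> = (\<pi> ^^ (n + j)) (p 0)" using j by (simp add: funpow_add funpow_pi_r add.commute[of n l])
      finally have "(\<pi> ^^ (l + k)) z \<in> range p" unfolding funpow_p by simp
      then show "z \<in> range p" by (rule down_closed[OF z])
    qed
  qed (use pV in auto)
  have "E = (\<Union>i. {{p i, p (i + 1)}})"
  proof
    show "(\<Union>i. {{p i, p (i + 1)}}) \<subseteq> E" using pi_edge[OF pV] pi_p by auto
    show "E \<subseteq> (\<Union>i. {{p i, p (i + 1)}})"
    proof
      fix e assume "e \<in> E"
      then obtain a where "a \<in> V" "e = {a, \<pi> a}" by (rule edge_cases)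
      then show "e \<in> (\<Union>i. {{p i, p (i + 1)}})" using VR pi_p by auto
    qed
  qed
  then show ?thesis using inj VR unfolding is_double_ray_graph_def by blast
qed

lemma desc_self_connected:
  assumes F: "F = {e \<in> E. e \<subseteq> desc y}" and y: "y \<in> V" and x: "x \<in> desc y"
  shows "(x, y) \<in> (adj_rel F)\<^sup>*"
proof -
  obtain k where "(\<pi> ^^ k) x = y" using x by (auto simp: desc_def)
  then show ?thesis using x
  proof (induction k arbitrary: x)
    case (Suc k)
    show ?case
    proof (cases "x = y")
      case False
      have xV: "x \<in> V" using Suc.prems by (simp add: desc_def)
      then have d: "\<pi> x \<in> desc y" using desc_pi_iff[OF xV False] Suc.prems by simp
      then have "(x, \<pi> x) \<in> adj_rel F" using Suc.prems pi_edge[OF xV] by (simp add: F adj_rel_def)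
      moreover have "(\<pi> x, y) \<in> (adj_rel F)\<^sup>*"
        using Suc.IH[of "\<pi> x"] Suc.prems d by (simp add: funpow_swap1)
      ultimately show ?thesis by (rule converse_rtrancl_into_rtrancl)
    qed simp
  qed simp
qed

text \<open>Past all branch vertices on \<open>r\<close>, the only child of a ray vertex is its
  predecessor. Hence everything outside the rest of the ray descends from a single ray vertex, and
  its descendants form the finite tree.\<close>

lemma finite_tree_with_ray_if_finite_desc:
  assumes fd: "\<And>x. x \<in> V \<Longrightarrow> finite (desc x)" and fB: "finite (branch_vertices V E)"
  shows "finite_tree_with_ray V E"
proof -
  obtain M where M: "\<And>n. n \<ge> M \<Longrightarrow> r n \<notin> branch_vertices V E"
    using finite_vimage_tail[OF inj_r fB] by blast
  define VK where "VK = desc (r M)"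
  define EK where "EK = {e \<in> E. e \<subseteq> desc (r M)}"
  \<comment> \<open>The index starts at \<open>Suc M\<close>: the vertex \<open>r M\<close> belongs
    to the finite tree and may even be a leaf, whereas each \<open>q n\<close> has the child
    \<open>r (M + n)\<close>.\<close>
  define q where "q n = r (Suc M + n)" for n
  have pi_q: "\<pi> (q n) = q (Suc n)" for n by (simp add: q_def pi_r)
  have pi_rM: "\<pi> (r M) = q 0" by (simp add: q_def pi_r)
  have deg: "degree E (q n) = 2" and ch: "children (q n) = {r (M + n)}" for n
  proof -
    have "r (M + n) \<in> children (q n)" using r_in_V pi_r by (simp add: children_def q_def)
    moreover have "card (children (q n)) \<le> 1"
      using M[of "Suc M + n"] degree_eq[OF r_in_V, of "Suc M + n"] r_in_V
      by (simp add: q_def branch_vertices_def)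
    ultimately show "children (q n) = {r (M + n)}"
      using finite_children[OF r_in_V, of "Suc M + n"]
      by (metis One_nat_def card_le_Suc0_iff_eq empty_iff is_singletonI' is_singleton_the_elem
          q_def singletonD)
    then show "degree E (q n) = 2" using degree_eq[OF r_in_V, of "Suc M + n"] by (simp add: q_def)
  qed
  have disj: "VK \<inter> range q = {}"
    using inj_r by (auto simp: VK_def desc_def q_def funpow_pi_r inj_eq)
  have Vsub: "x \<in> VK \<union> range q" if "x \<in> V" "(\<pi> ^^ k) x = r n" for x k n
    using that
  proof (induction k arbitrary: x)
    case 0
    show ?case
    proof (cases "n \<le> M")
      case True
      then have "(\<pi> ^^ (M - n)) x = r M" using 0 by (simp add: funpow_pi_r)
      then show ?thesis using 0 by (auto simp: VK_def desc_def)
    next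
      case False
      then have "x = q (n - Suc M)" using 0 by (simp add: q_def)
      then show ?thesis by simp
    qed
  next
    case (Suc k)
    then consider "\<pi> x \<in> VK" | n where "\<pi> x = q n"
      using Suc.IH[of "\<pi> x"] pi_in_V by (auto simp: funpow_swap1)
    then show ?case
    proof cases
      case 1
      then show ?thesis using desc_pi_iff[OF Suc.prems(1), of "r M"] desc_refl[OF r_in_V]
        by (cases "x = r M") (auto simp: VK_def)
    next
      case (2 n)
      then have "x \<in> children (q n)" using Suc.prems(1) by (simp add: children_def)
      then have x: "x = r (M + n)" by (simp add: ch)
      show ?thesis
      proof (cases n)
        case 0
        then show ?thesis using x desc_refl[OF r_in_V] by (simp add: VK_def)
      next
        case (Suc j)
        then have "x = q j" using x by (simp add: q_def)
        then show ?thesis by simp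
      qed
    qed
  qed
  have VKV: "VK \<subseteq> V" by (auto simp: VK_def desc_def)
  have V: "V = VK \<union> range q"
  proof
    show "V \<subseteq> VK \<union> range q" using Vsub reaches_ray by blast
    show "VK \<union> range q \<subseteq> V" using VKV r_in_V by (auto simp: q_def)
  qed
  have half: "{a, \<pi> a} \<in> EK \<union> {{r M, q 0}} \<union> (\<Union>n. {{q n, q (Suc n)}})" if "a \<in> V" for a
  proof (cases "a \<in> VK")
    case True
    show ?thesis
    proof (cases "a = r M")
      case False
      then have "\<pi> a \<in> VK" using True desc_pi_iff[OF that] by (simp add: VK_def)
      then show ?thesis using True pi_edge[OF that] by (simp add: EK_def VK_def)
    qed (simp add: pi_rM)
  next
    case False
    then obtain n where "a = q n" using V \<open>a \<in> V\<close> by auto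
    then show ?thesis using pi_q by auto
  qed
  have E: "E = EK \<union> {{r M, q 0}} \<union> (\<Union>n. {{q n, q (Suc n)}})"
  proof
    show "E \<subseteq> EK \<union> {{r M, q 0}} \<union> (\<Union>n. {{q n, q (Suc n)}})"
    proof
      fix e assume "e \<in> E"
      then obtain a where "a \<in> V" "e = {a, \<pi> a}" by (rule edge_cases)
      then show "e \<in> EK \<union> {{r M, q 0}} \<union> (\<Union>n. {{q n, q (Suc n)}})" using half[of a] by simp
    qed
    have "{r n, r (Suc n)} \<in> E" for n using pi_edge[OF r_in_V[of n]] by (simp add: pi_r)
    from this[of M] this show "EK \<union> {{r M, q 0}} \<union> (\<Union>n. {{q n, q (Suc n)}}) \<subseteq> E"
      by (auto simp: EK_def q_def)
  qed
  have "is_tree VK EK"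
  proof -
    have "simple_graph VK EK" using tree
      by (auto simp: is_tree_def connected_graph_def simple_graph_def EK_def VK_def)
    moreover have "r M \<in> VK" using desc_refl[OF r_in_V] by (simp add: VK_def)
    moreover have "(x, y) \<in> (adj_rel EK)\<^sup>*" if "x \<in> VK" "y \<in> VK" for x y
    proof -
      have "(x, r M) \<in> (adj_rel EK)\<^sup>*" "(y, r M) \<in> (adj_rel EK)\<^sup>*"
        using desc_self_connected[OF EK_def r_in_V] that by (auto simp: VK_def)
      moreover have "sym (adj_rel EK)" by (auto simp: sym_def adj_rel_def insert_commute)
      ultimately show ?thesis by (meson rtrancl_trans sym_rtrancl symD)
    qed
    moreover have "\<not> is_cycle EK xs" for xs
    proof
      assume "is_cycle EK xs"
      then have "is_cycle E xs" unfolding is_cycle_def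
        by (auto simp: EK_def elim: successively_mono)
      then show False using tree by (auto simp: is_tree_def)
    qed
    ultimately show ?thesis by (auto simp: is_tree_def connected_graph_def)
  qed
  moreover have "finite VK" using fd r_in_V by (simp add: VK_def)
  moreover have "r M \<in> VK" using desc_refl[OF r_in_V] by (simp add: VK_def)
  moreover have injq: "inj q" by (rule injI) (simp add: q_def inj_eq[OF inj_r])
  moreover have "degree_two_ray E q"
    using injq deg pi_q pi_edge[OF r_in_V] E by (auto simp: degree_two_ray_def is_ray_def)
  ultimately show ?thesis unfolding finite_tree_with_ray_def using disj V E by blast
qed

end

section \<open>Ends and distortion\<close>

context ray_oriented_tree
begin

text \<open>Deleting \<open>x\<close> separates its proper descendants, where \<open>s\<close> runs,
  from the vertices above \<open>x\<close>: by \<open>desc_pi_iff\<close> no edge avoiding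
  \<open>x\<close> crosses the boundary of \<open>desc x\<close>.\<close>

lemma ends_differ_if_infinite_desc:
  assumes x: "x \<in> V" and s: "s 0 = x" "\<And>n. s n \<in> V" "\<And>n. \<pi> (s (Suc n)) = s n"
  shows "((\<lambda>n. (\<pi> ^^ n) x), s) \<notin> end_rel V E"
proof
  assume "((\<lambda>n. (\<pi> ^^ n) x), s) \<in> end_rel V E"
  then obtain N where N: "\<And>m n. N \<le> m \<Longrightarrow> N \<le> n \<Longrightarrow>
      same_component_minus V E {x} ((\<pi> ^^ m) x) (s n)"
    using x unfolding end_rel_def by fastforce
  let ?A = "adj_rel {e \<in> E. e \<inter> {x} = {}}"
  have walk: "((\<pi> ^^ Suc N) x, s N) \<in> ?A\<^sup>*"
    using N[of "Suc N" N] by (simp add: same_component_minus_def)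
  have "(\<pi> ^^ Suc N) x \<notin> desc x"
  proof
    assume "(\<pi> ^^ Suc N) x \<in> desc x"
    then obtain k where "(\<pi> ^^ k) ((\<pi> ^^ Suc N) x) = x" by (auto simp: desc_def)
    then have "(\<pi> ^^ (k + Suc N)) x = x" by (metis comp_apply funpow_add)
    then show False using funpow_pi_neq[OF x, of "k + Suc N"] by simp
  qed
  with walk have "s N \<notin> desc x"
  proof (induction rule: rtrancl_induct)
    case (step a b)
    then have e: "{a, b} \<in> E" "a \<noteq> x" "b \<noteq> x" by (auto simp: adj_rel_def)
    then show ?case
      using edge_pi[OF e(1)] edge_D[OF e(1)] step desc_pi_iff[of a x] desc_pi_iff[of b x] by auto
  qed
  moreover have "(\<pi> ^^ N) (s N) = x"
  proof (induction N)
    case (Suc n)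
    then show ?case by (simp add: funpow_swap1 s)
  qed (simp add: s)
  ultimately show False using s(2) by (auto simp: desc_def)
qed

end

section \<open>Counting ends\<close>

lemma ray_in_vertices:
  assumes "simple_graph V E" "is_ray E s" shows "s n \<in> V"
  using assms unfolding simple_graph_def is_ray_def by (meson insert_subset)

lemma ray_tail_connected:
  assumes s: "is_ray E s" and S: "\<And>n. n \<ge> N \<Longrightarrow> s n \<notin> S" and ab: "N \<le> a" "N \<le> b"
  shows "(s a, s b) \<in> (adj_rel {e \<in> E. e \<inter> S = {}})\<^sup>*"
proof -
  let ?A = "adj_rel {e \<in> E. e \<inter> S = {}}"
  have up: "(s c, s d) \<in> ?A\<^sup>*" if "N \<le> c" "c \<le> d" for c d
    using that(2)
  proof (induction rule: dec_induct)
    case (step n)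
    have "(s n, s (Suc n)) \<in> ?A"
      using s S[of n] S[of "Suc n"] step.hyps that(1) by (auto simp: adj_rel_def is_ray_def)
    then show ?case using step.IH by (rule rtrancl_into_rtrancl[rotated])
  qed simp
  have "sym ?A" by (auto simp: sym_def adj_rel_def insert_commute)
  then show ?thesis using up ab by (meson nle_le sym_rtrancl symD)
qed

text \<open>Serves to turn an equality of end classes into relatedness: a ray must belong to its own
  class.\<close>

lemma end_rel_refl:
  assumes "simple_graph V E" "is_ray E s"
  shows "(s, s) \<in> end_rel V E"
proof -
  have "\<exists>N. \<forall>m\<ge>N. \<forall>n\<ge>N. same_component_minus V E S (s m) (s n)" if S: "finite S" for S
  proof -
    obtain N where N: "\<And>n. n \<ge> N \<Longrightarrow> s n \<notin> S"
      using finite_vimage_tail[of s S] assms(2) S by (auto simp: is_ray_def)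
    show ?thesis using N ray_tail_connected[OF assms(2) N] ray_in_vertices[OF assms]
      by (intro exI[of _ N]) (auto simp: same_component_minus_def)
  qed
  then show ?thesis using assms(2) by (simp add: end_rel_def)
qed

text \<open>Infinitely many descendants would give a ray going down from \<open>x\<close>, and its
  end differs from that of the orbit going up.\<close>

lemma (in ray_oriented_tree) finite_desc_if_one_end:
  assumes one: "card (ends V E) = 1" and x: "x \<in> V"
  shows "finite (desc x)"
proof (rule ccontr)
  assume "infinite (desc x)"
  then obtain s where s: "s 0 = x" "\<And>n. s n \<in> V" "\<And>n. \<pi> (s (Suc n)) = s n"
    using infinite_desc_path[OF x] by blast
  have simple: "simple_graph V E" using tree by (simp add: is_tree_def connected_graph_def)
  have pi_s: "(\<pi> ^^ k) (s (n + k)) = s n" for n k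
    by (induction k) (auto simp: funpow_swap1 s(3) simp del: funpow.simps simp: funpow.simps(2))
  have neq: "s i \<noteq> s j" if "i < j" for i j
    using pi_s[of "j - i" i] funpow_pi_neq[OF s(2)[of j], of "j - i"] that by auto
  have "inj s" by (rule injI) (metis neq nat_neq_iff)
  then have ray: "is_ray E s"
    using pi_edge[OF s(2)] s(3) by (auto simp: is_ray_def insert_commute) (metis insert_commute)
  let ?q = "\<lambda>n. (\<pi> ^^ n) x"
  obtain C where C: "ends V E = {C}" using one by (auto simp: card_1_singleton_iff)
  have "end_rel V E `` {?q} \<in> ends V E" "end_rel V E `` {s} \<in> ends V E"
    using ray pi_orbit_is_ray[OF x] by (auto simp: ends_def intro: quotientI)
  then have "end_rel V E `` {?q} = end_rel V E `` {s}" using C by simp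
  moreover have "s \<in> end_rel V E `` {s}" using end_rel_refl[OF simple ray] by simp
  ultimately have "(?q, s) \<in> end_rel V E" by blast
  then show False using ends_differ_if_infinite_desc[OF x s] by simp
qed

text \<open>Any ray is injective and so leaves every finite set, in particular
  \<open>V - range r\<close> together with an initial segment of \<open>r\<close>. From then on it
  stays on a connected tail of \<open>r\<close> that avoids \<open>S\<close>.\<close>

lemma one_end_if_cofinite_ray:
  assumes simple: "simple_graph V E" and r: "is_ray E r" and fin: "finite (V - range r)"
  shows "card (ends V E) = 1"
proof -
  have rel: "(s, t) \<in> end_rel V E" if st: "is_ray E s" "is_ray E t" for s t
  proof -
    have "\<exists>N. \<forall>m\<ge>N. \<forall>n\<ge>N. same_component_minus V E S (s m) (t n)" if S: "finite S" for S
    proof -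
      obtain M where M: "\<And>n. n \<ge> M \<Longrightarrow> r n \<notin> S"
        using finite_vimage_tail[of r S] r S by (auto simp: is_ray_def)
      define F where "F = (V - range r) \<union> r ` {..<M}"
      have "finite F" using fin by (simp add: F_def)
      then obtain N1 N2 where N: "\<And>n. n \<ge> N1 \<Longrightarrow> s n \<notin> F" "\<And>n. n \<ge> N2 \<Longrightarrow> t n \<notin> F"
        using finite_vimage_tail[of s F] finite_vimage_tail[of t F] st by (metis is_ray_def)
      have tail: "\<exists>a\<ge>M. v = r a" if "v \<in> V" "v \<notin> F" for v
        using that by (force simp: F_def not_less)
      have "same_component_minus V E S (s m) (t n)" if mn: "max N1 N2 \<le> m" "max N1 N2 \<le> n" for m n
      proof -
        obtain a b where "a \<ge> M" "s m = r a" "b \<ge> M" "t n = r b"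
          using tail[of "s m"] tail[of "t n"] N mn st ray_in_vertices[OF simple] by auto
        then show ?thesis
          using M ray_tail_connected[OF r M] ray_in_vertices[OF simple r]
          by (auto simp: same_component_minus_def)
      qed
      then show ?thesis by blast
    qed
    then show ?thesis using st by (simp add: end_rel_def)
  qed
  have "end_rel V E `` {s} = {t. is_ray E t}" if "is_ray E s" for s
    using rel that by (auto simp: end_rel_def)
  then have "ends V E = {{t. is_ray E t}}" using r by (auto simp: ends_def quotient_def)
  then show ?thesis by simp
qed

text \<open>A shift only moves the threshold \<open>N\<close>, so the two classes coincide as sets
  directly from the definition.\<close>

lemma end_class_shift:
  assumes "is_ray E q" "is_ray E s" and s: "\<And>n. s n = q (n + a)"
  shows "end_rel V E `` {s} = end_rel V E `` {q}"
proof -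
  have "(\<exists>N. \<forall>m\<ge>N. \<forall>n\<ge>N. same_component_minus V E S (s m) (t n)) \<longleftrightarrow>
      (\<exists>N. \<forall>m\<ge>N. \<forall>n\<ge>N. same_component_minus V E S (q m) (t n))" for S t
  proof
    assume "\<exists>N. \<forall>m\<ge>N. \<forall>n\<ge>N. same_component_minus V E S (s m) (t n)"
    then obtain N where N: "\<And>m n. N \<le> m \<Longrightarrow> N \<le> n \<Longrightarrow> same_component_minus V E S (s m) (t n)"
      by blast
    have "same_component_minus V E S (q m) (t n)" if "N + a \<le> m" "N + a \<le> n" for m n
      using N[of "m - a" n] that by (simp add: s)
    then show "\<exists>N. \<forall>m\<ge>N. \<forall>n\<ge>N. same_component_minus V E S (q m) (t n)" by blast
  next
    assume "\<exists>N. \<forall>m\<ge>N. \<forall>n\<ge>N. same_component_minus V E S (q m) (t n)"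
    then show "\<exists>N. \<forall>m\<ge>N. \<forall>n\<ge>N. same_component_minus V E S (s m) (t n)"
      unfolding s by (meson trans_le_add1)
  qed
  then show ?thesis using assms(1,2) by (auto simp: end_rel_def)
qed

section \<open>The double ray\<close>

locale double_ray =
  fixes V :: "'a set" and E :: "'a set set" and p :: "int \<Rightarrow> 'a"
  assumes inj_p: "inj p" and V_eq: "V = range p" and E_eq: "E = (\<Union>i. {{p i, p (i + 1)}})"
begin

lemma edge_iff: "{p i, p j} \<in> E \<longleftrightarrow> j = i + 1 \<or> i = j + 1"
  using inj_p by (auto simp: E_eq doubleton_eq_iff inj_eq)

lemma nbrs_p: "nbrs E (p i) = {p (i - 1), p (i + 1)}"
proof -
  have "{p i, y} \<in> E \<Longrightarrow> y \<in> range p" for y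
    by (auto simp: E_eq doubleton_eq_iff)
  then have "nbrs E (p i) = p ` {j. {p i, p j} \<in> E}" by (auto simp: nbrs_def)
  also have "{j. {p i, p j} \<in> E} = {i - 1, i + 1}" by (auto simp: edge_iff)
  finally show ?thesis by simp
qed

lemma degree_p: "degree E (p i) = 2"
  using inj_p by (simp add: degree_def nbrs_p inj_eq)

text \<open>In integer coordinates a ray moves by steps of 1 or -1, and injectivity forbids it to
  turn back.\<close>

lemma ray_cases:
  assumes s: "is_ray E s"
  obtains c where "\<And>n. s n = p (c + int n)" | c where "\<And>n. s n = p (c - int n)"
proof -
  have e: "{s n, s (Suc n)} \<in> E" and inj: "inj s" for n using s by (auto simp: is_ray_def)
  have "\<exists>i. s n = p i" for n using e[of n] by (auto simp: E_eq doubleton_eq_iff)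
  then obtain g where g: "\<And>n. s n = p (g n)" by metis
  have adj: "g (Suc n) = g n + 1 \<or> g (Suc n) = g n - 1" for n
    using e[of n] edge_iff by (auto simp: g)
  have neq: "g (Suc (Suc n)) \<noteq> g n" for n
    using inj_eq[OF inj, of "Suc (Suc n)" n] by (auto simp: g)
  show thesis
  proof (cases "g 1 = g 0 + 1")
    case True
    have "g n = g 0 + int n \<and> g (Suc n) = g 0 + int n + 1" for n
    proof (induction n)
      case (Suc n)
      then show ?case using adj[of "Suc n"] neq[of n] by auto
    qed (use True in auto)
    then show thesis using that(1) g by metis
  next
    case False
    have "g n = g 0 - int n \<and> g (Suc n) = g 0 - int n - 1" for n
    proof (induction n)
      case (Suc n)
      then show ?case using adj[of "Suc n"] neq[of n] by auto
    qed (use False adj[of 0] in auto)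
    then show thesis using that(2) g by metis
  qed
qed

lemma is_ray_up: "is_ray E (\<lambda>n. p (c + int n))"
  by (auto simp: is_ray_def edge_iff intro!: injI dest!: injD[OF inj_p])

lemma is_ray_down: "is_ray E (\<lambda>n. p (c - int n))"
  by (auto simp: is_ray_def edge_iff intro!: injI dest!: injD[OF inj_p])

text \<open>Finiteness is recorded separately because \<open>card\<close> is 0 on infinite sets, so
  the bound alone would not exclude infinitely many ends.\<close>

lemma finite_ends: "finite (ends V E)" and card_ends_le: "card (ends V E) \<le> 2"
proof -
  let ?C = "end_rel V E `` {\<lambda>n. p (int n)}" and ?D = "end_rel V E `` {\<lambda>n. p (- int n)}"
  have "end_rel V E `` {s} \<in> {?C, ?D}" if s: "is_ray E s" for s
    using s
  proof (cases rule: ray_cases)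
    case (1 c)
    have "end_rel V E `` {s} = ?C"
    proof (cases "0 \<le> c")
      case True
      show ?thesis
        by (rule end_class_shift[where a = "nat c"])
          (use 1 True is_ray_up[of 0] s in \<open>auto simp: add.commute\<close>)
    next
      case False
      show ?thesis
        by (rule end_class_shift[where a = "nat (- c)", symmetric])
          (use 1 False is_ray_up[of 0] s in auto)
    qed
    then show ?thesis by simp
  next
    case (2 c)
    have "end_rel V E `` {s} = ?D"
    proof (cases "0 \<le> c")
      case True
      show ?thesis
        by (rule end_class_shift[where a = "nat c", symmetric])
          (use 2 True is_ray_down[of 0] s in auto)
    next
      case False
      show ?thesis
        by (rule end_class_shift[where a = "nat (- c)"])
          (use 2 False is_ray_down[of 0] s in \<open>auto simp: algebra_simps\<close>)
    qed
    then show ?thesis by simp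
  qed
  then have sub: "ends V E \<subseteq> {?C, ?D}" by (auto simp: ends_def quotient_def)
  then show "finite (ends V E)" by (rule finite_subset) simp
  have "card (ends V E) \<le> card {?C, ?D}" using sub by (intro card_mono) auto
  also have "\<dots> \<le> 2" by (simp add: card_insert_if)
  finally show "card (ends V E) \<le> 2" .
qed

end

lemma is_double_ray_graph_iff: "is_double_ray_graph V E \<longleftrightarrow> (\<exists>p. double_ray V E p)"
  by (simp add: is_double_ray_graph_def double_ray_def)

text \<open>The bounds are the infimum and the supremum themselves, so that the distortion equals
  \<open>M / m\<close> and the estimate for branch vertices loses nothing.\<close>

lemma distortion_bounds:
  assumes ne: "E \<noteq> {}" and pos: "\<And>e. e \<in> E \<Longrightarrow> 0 < w e" and fin: "distortion E w < \<infinity>"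
  obtains m M where "0 < m" "\<And>e. e \<in> E \<Longrightarrow> m \<le> w e" "\<And>e. e \<in> E \<Longrightarrow> w e \<le> M"
    "distortion E w = ereal (M / m)"
proof -
  define s where "s = (SUP e\<in>E. ereal (w e))"
  define i where "i = (INF e\<in>E. ereal (w e))"
  have dist: "distortion E w = (if s = \<infinity> \<or> i = 0 then \<infinity> else s / i)"
    by (simp add: distortion_def Let_def s_def i_def)
  then have si: "s \<noteq> \<infinity>" "i \<noteq> 0" using fin by (auto split: if_splits)
  obtain e0 where e0: "e0 \<in> E" using ne by blast
  have le: "i \<le> ereal (w e)" "ereal (w e) \<le> s" if "e \<in> E" for e
    using that by (auto simp: s_def i_def intro: INF_lower SUP_upper)
  have "0 \<le> i" unfolding i_def using pos by (intro INF_greatest) (simp add: less_imp_le)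
  then obtain m where m: "i = ereal m" "0 < m" using si le(1)[OF e0] by (cases i) auto
  obtain M where M: "s = ereal M" using si le(2)[OF e0] by (cases s) auto
  show thesis
    by (rule that[of m M]) (use m M le si dist in auto)
qed

text \<open>An edge keeps the supremum and infimum of a two-sidedly bounded weight real; over no
  edges they would be infinite.\<close>

lemma DN_LLY_finite_iff:
  assumes ne: "E \<noteq> {}"
  shows "DN_LLY E < \<infinity> \<longleftrightarrow> (\<exists>w m M. admissible E w \<and> 0 < m \<and> (\<forall>e\<in>E. m \<le> w e \<and> w e \<le> M))"
proof
  assume "DN_LLY E < \<infinity>"
  then obtain w where w: "admissible E w" "distortion E w < \<infinity>"
    unfolding DN_LLY_def INF_less_iff by blast
  have "\<And>e. e \<in> E \<Longrightarrow> 0 < w e" using w(1) by (simp add: admissible_def)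
  then show "\<exists>w m M. admissible E w \<and> 0 < m \<and> (\<forall>e\<in>E. m \<le> w e \<and> w e \<le> M)"
    using distortion_bounds[OF ne _ w(2)] w(1) by metis
next
  assume "\<exists>w m M. admissible E w \<and> 0 < m \<and> (\<forall>e\<in>E. m \<le> w e \<and> w e \<le> M)"
  then obtain w m M where w: "admissible E w" and m: "0 < m" "\<And>e. e \<in> E \<Longrightarrow> m \<le> w e"
    and M: "\<And>e. e \<in> E \<Longrightarrow> w e \<le> M" by blast
  obtain e0 where e0: "e0 \<in> E" using ne by blast
  define s where "s = (SUP e\<in>E. ereal (w e))"
  define i where "i = (INF e\<in>E. ereal (w e))"
  have "ereal (w e0) \<le> s" "s \<le> ereal M" "ereal m \<le> i" "i \<le> ereal (w e0)"
    using e0 m M by (auto simp: s_def i_def intro: INF_lower SUP_upper INF_greatest SUP_least)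
  then obtain s' i' where "s = ereal s'" "i = ereal i'" "0 < i'"
    using m(1) by (cases s; cases i) auto
  then have "distortion E w < \<infinity>"
    by (simp add: distortion_def Let_def flip: s_def i_def)
  then show "DN_LLY E < \<infinity>" using w unfolding DN_LLY_def INF_less_iff by blast
qed

context ray_oriented_tree
begin

lemma edges_nonempty: "E \<noteq> {}"
  using pi_edge r_in_V by blast

text \<open>The count is a lower bound for the distortion of every admissible weight, hence for the
  infimum, whether or not this is attained.\<close>

lemma card_branch_vertices_le_DN:
  assumes "DN_LLY E < \<infinity>"
  shows "finite (branch_vertices V E)"
    "int (card (branch_vertices V E)) \<le> \<lceil>real_of_ereal (DN_LLY E)\<rceil>"
proof -
  show "finite (branch_vertices V E)"
    using assms card_branch_vertices_le(1) unfolding DN_LLY_finite_iff[OF edges_nonempty] by blast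
  have "ereal (card (branch_vertices V E)) \<le> DN_LLY E" unfolding DN_LLY_def
  proof (rule INF_greatest)
    fix w assume "w \<in> {w. admissible E w}"
    then have adm: "admissible E w" by simp
    then have pos: "\<And>e. e \<in> E \<Longrightarrow> 0 < w e" by (simp add: admissible_def)
    show "ereal (card (branch_vertices V E)) \<le> distortion E w"
    proof (cases "distortion E w < \<infinity>")
      case True
      obtain m M where "0 < m" "\<And>e. e \<in> E \<Longrightarrow> m \<le> w e" "\<And>e. e \<in> E \<Longrightarrow> w e \<le> M"
        "distortion E w = ereal (M / m)"
        using distortion_bounds[OF edges_nonempty pos True] by blast
      then show ?thesis using card_branch_vertices_le(2)[OF adm, of m M] by simp
    qed simp
  qed
  \<comment> \<open>The infimum is finite by assumption and at least a cardinality, so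
    \<open>real_of_ereal\<close> returns its true value and not a default.\<close>
  then have "real (card (branch_vertices V E)) \<le> real_of_ereal (DN_LLY E)"
    using assms by (cases "DN_LLY E") auto
  then show "int (card (branch_vertices V E)) \<le> \<lceil>real_of_ereal (DN_LLY E)\<rceil>"
    by linarith
qed

lemma DN_finite_imp_structure:
  assumes "DN_LLY E < \<infinity>"
  shows "is_double_ray_graph V E \<or> finite_tree_with_ray V E"
proof -
  obtain w m where w: "admissible E w" "0 < m" "\<And>e. e \<in> E \<Longrightarrow> m \<le> w e"
    using assms unfolding DN_LLY_finite_iff[OF edges_nonempty] by blast
  show ?thesis
    using double_ray_if_infinite_desc[OF w] finite_tree_with_ray_if_finite_desc
      card_branch_vertices_le_DN(1)[OF assms] by blast
qed

end

section \<open>Weights of finite distortion\<close>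

context ray_oriented_tree
begin

text \<open>For the constant weight 1 the edge inequality reads
  \<open>1 * (2 - 1) \<le> 1\<close>.\<close>

lemma DN_finite_if_all_degree_two:
  assumes deg: "\<And>x. x \<in> V \<Longrightarrow> degree E x = 2"
  shows "DN_LLY E < \<infinity>"
proof -
  let ?w = "\<lambda>e :: 'a set. 1 :: real"
  have "wdegree E ?w x = 2" if "x \<in> V" for x
    using deg[OF that] by (simp add: wdegree_def degree_def)
  moreover have "down ?w x = 1" if "x \<in> V" for x
    using deg[OF that] degree_eq[OF that] by (simp add: down_def up_def)
  ultimately have "admissible E ?w" by (simp add: admissible_iff pi_in_V up_def)
  then show ?thesis unfolding DN_LLY_finite_iff[OF edges_nonempty]
    by (intro exI[of _ ?w] exI[of _ 1]) simp
qed

text \<open>For a vertex of the tree this is its distance from the ray, the variable in which the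
  weight will decay.\<close>

definition depth :: "'a \<Rightarrow> nat" where "depth x = (LEAST j. (\<pi> ^^ j) x \<in> range r)"

lemma depth_on_ray: "x \<in> range r \<Longrightarrow> depth x = 0"
  unfolding depth_def by (rule Least_eq_0) simp

lemma depth_off_ray:
  assumes "x \<in> V" "x \<notin> range r"
  shows "depth x = Suc (depth (\<pi> x))"
proof -
  obtain k where "(\<pi> ^^ k) x \<in> range r" using reaches_ray[OF assms(1)] by (metis rangeI)
  then show ?thesis unfolding depth_def
    by (subst Least_Suc[of _ k]) (use assms(2) in \<open>simp_all add: funpow_swap1\<close>)
qed

lemma depth_pi_le: "x \<in> V \<Longrightarrow> depth (\<pi> x) \<le> depth x"
  using depth_off_ray[of x] depth_on_ray[of "\<pi> x"] pi_r by (cases "x \<in> range r") force+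

lemma children_off_ray:
  assumes "x \<notin> range r" shows "children x \<subseteq> V - range r"
  using assms pi_r by (auto simp: children_def)

text \<open>A deepest vertex has no children. The leaf is what distinguishes a finite tree with a
  ray from a double ray.\<close>

lemma leaf_if_finite_off_ray:
  assumes fin: "finite (V - range r)" and ne: "V - range r \<noteq> {}"
  obtains x where "x \<in> V" "degree E x = 1"
proof -
  have "Max (depth ` (V - range r)) \<in> depth ` (V - range r)" using fin ne by (intro Max_in) auto
  then obtain x where x: "x \<in> V - range r" and x_max: "depth x = Max (depth ` (V - range r))" by auto
  have max: "depth y \<le> depth x" if "y \<in> V - range r" for y
    unfolding x_max using fin that by (intro Max_ge) auto
  have "children x = {}"
  proof (rule ccontr)
    assume "children x \<noteq> {}"
    then obtain c where "c \<in> V - range r" "\<pi> c = x"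
      using children_off_ray[of x] x by (auto simp: children_def)
    then show False using depth_off_ray[of c] max[of c] by auto
  qed
  then show thesis using that[of x] x degree_eq[of x] by simp
qed

text \<open>The weight \<open>\<epsilon> ^ j\<^sup>2\<close> at depth \<open>j\<close> makes \<open>w\<^sub>j\<^sub>-\<^sub>1 w\<^sub>j\<^sub>+\<^sub>1 / w\<^sub>j\<^sup>2 = \<epsilon>\<^sup>2\<close>, which absorbs the vertex degrees
  of the finite part once \<open>\<epsilon>\<close> is small.\<close>

lemma DN_finite_if_cofinite_degree_two_ray:
  assumes deg: "\<And>n. degree E (r n) = 2" and fin: "finite (V - range r)"
  shows "DN_LLY E < \<infinity>"
proof -
  \<comment> \<open>\<open>N\<close> bounds the number of children of every vertex; the added 1
    covers the ray vertices, which have one child. The choice of \<epsilon> gives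
    \<open>N * \<epsilon> = 1 / 2\<close>, which leaves room for both terms of the final
    estimate.\<close>
  define N :: real where "N = card (V - range r) + 1"
  define \<epsilon> where "\<epsilon> = 1 / (2 * N)"
  have N1: "1 \<le> N" by (simp add: N_def)
  then have eps: "0 < \<epsilon>" "\<epsilon> \<le> 1" and Ne: "N * \<epsilon> = 1 / 2" by (auto simp: \<epsilon>_def)
  define u where "u x = \<epsilon> ^ (depth x)\<^sup>2" for x
  \<comment> \<open>The minimum selects the deeper end of the edge, because \<open>u\<close> does
    not increase with the depth.\<close>
  define w where "w e = Min (u ` e)" for e
  have u0: "0 < u x" and u1: "u x \<le> 1" for x using eps by (auto simp: u_def power_le_one)
  have up: "up w x = u x" if "x \<in> V" for x
  proof -
    have "u x \<le> u (\<pi> x)" unfolding u_def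
      using eps depth_pi_le[OF that] by (intro power_decreasing power_mono) auto
    then show ?thesis by (simp add: up_def w_def)
  qed
  have down: "down w x = sum u (children x)" for x
    unfolding down_def by (rule sum.cong) (auto simp: children_def up)
  have card1: "card (children (r n)) = 1" for n using degree_eq[OF r_in_V, of n] deg[of n] by simp
  have card: "real (card (children x)) \<le> N" for x
  proof (cases "x \<in> range r")
    case True
    then show ?thesis using card1 N1 by auto
  next
    case False
    then show ?thesis using card_mono[OF fin children_off_ray[OF False]] by (simp add: N_def)
  qed
  have down_le: "down w x \<le> N * b" if "\<And>c. c \<in> children x \<Longrightarrow> u c \<le> b" "0 \<le> b" for x b
  proof -
    have "down w x \<le> card (children x) * b" unfolding down using that(1) by (rule sum_bounded_above)
    also have "\<dots> \<le> N * b" using card that(2) by (rule mult_right_mono)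
    finally show ?thesis .
  qed
  have only_child: "children (r n) = {c}" if "c \<in> children (r n)" for n c
    using card1[of n] that by (auto simp: card_1_singleton_iff)
  have cond: "down w x * (wdegree E w (\<pi> x) - up w x) \<le> (up w x)\<^sup>2" if x: "x \<in> V" for x
  proof (cases "x \<in> range r")
    case True
    then obtain n where n: "x = r n" by blast
    \<comment> \<open>On the ray all weights are 1 and each vertex has a single child, so the
      inequality reduces to \<open>down w x \<le> 1\<close>.\<close>
    have ux: "u (r m) = 1" for m by (simp add: u_def depth_on_ray)
    obtain c where "children x = {c}" using card1[of n] n by (auto simp: card_1_singleton_iff)
    then have 1: "down w x \<le> 1" using u1 by (simp add: down)
    have "children (r (Suc n)) = {r n}"
      by (rule only_child) (use r_in_V pi_r in \<open>simp add: children_def\<close>)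
    then have "wdegree E w (\<pi> x) - up w x = 1"
      using n r_in_V by (simp add: wdegree_eq pi_r up down ux)
    then show ?thesis using 1 n ux up[OF x] by simp
  next
    case False
    define i where "i = depth (\<pi> x)"
    have dx: "depth x = Suc i" using depth_off_ray[OF x False] by (simp add: i_def)
    define A where "A = \<epsilon> ^ (Suc (Suc i))\<^sup>2"
    define B where "B = \<epsilon> ^ (Suc i)\<^sup>2"
    define C where "C = \<epsilon> ^ i\<^sup>2"
    have ABC: "0 < A" "0 < B" "0 < C" using eps by (auto simp: A_def B_def C_def)
    have upx: "up w x = B" by (simp add: up[OF x] u_def dx B_def)
    have d1: "down w x \<le> N * A"
    proof (rule down_le)
      fix c assume c: "c \<in> children x"
      then have "c \<in> V - range r" "\<pi> c = x" using children_off_ray[OF False] by (auto simp: children_def)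
      then show "u c \<le> A" using depth_off_ray[of c] dx by (simp add: u_def A_def)
    qed (use ABC in simp)
    \<comment> \<open>No sibling of \<open>x\<close> lies on the ray: a ray vertex below
      \<open>\<pi> x\<close> would be the only child of \<open>\<pi> x\<close>, hence equal to
      \<open>x\<close>. So all siblings have the depth of \<open>x\<close>.\<close>
    have d2: "down w (\<pi> x) \<le> N * B"
    proof (rule down_le)
      fix c assume c: "c \<in> children (\<pi> x)"
      show "u c \<le> B"
      proof (cases "c \<in> range r")
        case True
        then obtain n where "c = r n" by blast
        moreover from this c have "\<pi> x = r (Suc n)" using pi_r by (simp add: children_def)
        moreover have "x \<in> children (\<pi> x)" using x by (simp add: children_def)
        ultimately have "x = r n" using only_child[of c "Suc n"] c by auto
        then show ?thesis using False by simp
      next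
        case False
        then show ?thesis using c depth_off_ray[of c] by (simp add: children_def u_def B_def i_def)
      qed
    qed (use ABC in simp)
    have "wdegree E w (\<pi> x) - up w x \<le> C + N * B"
      using d2 upx ABC pi_in_V[OF x] by (simp add: wdegree_eq up u_def C_def i_def)
    moreover have "0 \<le> wdegree E w (\<pi> x) - up w x"
    proof -
      have "u x \<le> sum u (children (\<pi> x))"
        by (rule member_le_sum)
          (use x u0 finite_children[OF pi_in_V[OF x]] in \<open>auto simp: children_def less_imp_le\<close>)
      then show ?thesis using u0[of "\<pi> x"] x by (simp add: wdegree_eq up down pi_in_V)
    qed
    ultimately have "down w x * (wdegree E w (\<pi> x) - up w x) \<le> N * A * (C + N * B)"
      using d1 ABC N1 by (intro mult_mono) auto
    also have "\<dots> = N * (A * C) + N\<^sup>2 * (A * B)" by (simp add: algebra_simps power2_eq_square)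
    \<comment> \<open>The exponents satisfy \<open>(i + 2)^2 + i^2 = 2 * (i + 1)^2 + 2\<close> and,
      for \<open>A * B\<close>,
      \<open>(i + 2)^2 + (i + 1)^2 = 2 * (i + 1)^2 + (2 * i + 3)\<close>.\<close>
    also have "A * C = \<epsilon>\<^sup>2 * B\<^sup>2"
      unfolding A_def B_def C_def power_mult[symmetric] power_add[symmetric]
      by (rule arg_cong[where f = "\<lambda>n. \<epsilon> ^ n"]) (simp add: power2_eq_square algebra_simps)
    also have "A * B = \<epsilon> ^ (2 * i + 3) * B\<^sup>2"
      unfolding A_def B_def power_mult[symmetric] power_add[symmetric]
      by (rule arg_cong[where f = "\<lambda>n. \<epsilon> ^ n"]) (simp add: power2_eq_square algebra_simps)
    also have "N * (\<epsilon>\<^sup>2 * B\<^sup>2) + N\<^sup>2 * (\<epsilon> ^ (2 * i + 3) * B\<^sup>2) =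
        ((N * \<epsilon>) * \<epsilon> + (N * \<epsilon>)\<^sup>2 * \<epsilon> ^ (2 * i + 1)) * B\<^sup>2"
      by (simp add: algebra_simps power2_eq_square power3_eq_cube power_add)
    also have "\<dots> \<le> 1 * B\<^sup>2"
    proof (rule mult_right_mono)
      have "\<epsilon> ^ (2 * i + 1) \<le> 1" using eps by (intro power_le_one) auto
      then show "(N * \<epsilon>) * \<epsilon> + (N * \<epsilon>)\<^sup>2 * \<epsilon> ^ (2 * i + 1) \<le> 1"
        unfolding Ne using eps by (simp add: power2_eq_square)
    qed simp
    finally show ?thesis by (simp add: upx)
  qed
  have w_u: "\<exists>x\<in>V. w e = u x" if "e \<in> E" for e
    using that up by (metis edge_cases up_def)
  have "0 < w e" if "e \<in> E" for e using w_u[OF that] u0 by auto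
  then have "admissible E w" using cond by (simp add: admissible_iff)
  obtain J where J: "\<And>x. x \<in> V \<Longrightarrow> depth x \<le> J"
  proof -
    have "depth ` V \<subseteq> insert 0 (depth ` (V - range r))" using depth_on_ray by auto
    then have "finite (depth ` V)" using fin by (meson finite_imageI finite_insert finite_subset)
    then show thesis using that[of "Max (depth ` V)"] by simp
  qed
  have "\<epsilon> ^ J\<^sup>2 \<le> u x" if "x \<in> V" for x
    unfolding u_def using eps J[OF that] by (intro power_decreasing power_mono) auto
  then have "\<epsilon> ^ J\<^sup>2 \<le> w e \<and> w e \<le> 1" if "e \<in> E" for e
    using w_u[OF that] u1 by auto
  moreover have "0 < \<epsilon> ^ J\<^sup>2" using eps by simp
  ultimately show ?thesis unfolding DN_LLY_finite_iff[OF edges_nonempty]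
    using \<open>admissible E w\<close> by blast
qed

end

section \<open>The characterisation\<close>

lemma finite_tree_with_ray_cofinite:
  assumes "finite_tree_with_ray V E"
  obtains r where "degree_two_ray E r" "finite (V - range r)" "V - range r \<noteq> {}"
proof -
  obtain VK r k where "finite VK" "k \<in> VK" "VK \<inter> range r = {}" "V = VK \<union> range r"
    "degree_two_ray E r"
    using assms unfolding finite_tree_with_ray_def by blast
  moreover from this have "V - range r = VK" by blast
  ultimately show thesis using that[of r] by auto
qed

theorem theorem1p7:
  fixes V :: "'a set" and E :: "'a set set"
  assumes "is_tree V E" and "locally_finite V E" and "infinite V"
  shows
    "(DN_LLY E < \<infinity> \<longleftrightarrow>
        (is_double_ray_graph V E \<or> finite_tree_with_ray V E) \<and>
        \<not> (is_double_ray_graph V E \<and> finite_tree_with_ray V E)) \<and>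
     (finite_tree_with_ray V E \<longleftrightarrow>
        card (ends V E) = 1 \<and> finite (branch_vertices V E)) \<and>
     (DN_LLY E < \<infinity> \<longrightarrow>
        finite (branch_vertices V E) \<and>
        int (card (branch_vertices V E)) \<le> \<lceil>real_of_ereal (DN_LLY E)\<rceil>) \<and>
     (DN_LLY E < \<infinity> \<longrightarrow>
        finite (ends V E) \<and> card (ends V E) \<le> 2 \<and>
        (card (ends V E) = 2 \<longrightarrow> is_double_ray_graph V E))"
proof -
  let ?D = "is_double_ray_graph V E" and ?F = "finite_tree_with_ray V E"
  have simple: "simple_graph V E" using assms(1) by (simp add: is_tree_def connected_graph_def)
  obtain r where "is_ray E r" by (rule infinite_tree_has_ray[OF assms])
  then obtain \<pi> where "ray_oriented_tree V E r \<pi>" by (rule ray_orientation[OF assms(1,2)])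
  then interpret T: ray_oriented_tree V E r \<pi> .
  have F: "DN_LLY E < \<infinity>" "card (ends V E) = 1" "finite (branch_vertices V E)" "\<not> ?D" if tree_with_ray: ?F
  proof -
    obtain q where q: "degree_two_ray E q" "finite (V - range q)" "V - range q \<noteq> {}"
      by (rule finite_tree_with_ray_cofinite[OF tree_with_ray])
    have ray: "is_ray E q" and deg: "\<And>n. degree E (q n) = 2"
      using q(1) by (auto simp: degree_two_ray_def)
    \<comment> \<open>The tree is oriented anew towards \<open>q\<close>, since the ray
      \<open>r\<close> chosen before need not consist of vertices of degree two.\<close>
    obtain \<tau> where "ray_oriented_tree V E q \<tau>" by (rule ray_orientation[OF assms(1,2) ray])
    then interpret Q: ray_oriented_tree V E q \<tau> .
    show "DN_LLY E < \<infinity>" using Q.DN_finite_if_cofinite_degree_two_ray deg q(2) by blast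
    show "card (ends V E) = 1" by (rule one_end_if_cofinite_ray[OF simple ray q(2)])
    have "branch_vertices V E \<subseteq> V - range q" using deg by (force simp: branch_vertices_def)
    then show "finite (branch_vertices V E)" using q(2) finite_subset by blast
    \<comment> \<open>A leaf cannot occur in a double ray, where all degrees are 2.\<close>
    obtain x where x: "x \<in> V" "degree E x = 1" by (rule Q.leaf_if_finite_off_ray[OF q(2,3)])
    show "\<not> ?D"
    proof
      assume ?D
      then obtain p where "double_ray V E p" by (auto simp: is_double_ray_graph_iff)
      then interpret double_ray V E p .
      show False using x degree_p by (auto simp: V_eq)
    qed
  qed
  have D: "DN_LLY E < \<infinity>" "finite (ends V E)" "card (ends V E) \<le> 2" if double: ?D
  proof -
    obtain p where "double_ray V E p" using double by (auto simp: is_double_ray_graph_iff)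
    then interpret P: double_ray V E p .
    show "DN_LLY E < \<infinity>" by (rule T.DN_finite_if_all_degree_two) (auto simp: P.V_eq P.degree_p)
    show "finite (ends V E)" "card (ends V E) \<le> 2" by (rule P.finite_ends P.card_ends_le)+
  qed
  have shape: "?D \<or> ?F" if "DN_LLY E < \<infinity>" by (rule T.DN_finite_imp_structure[OF that])
  have one_end: ?F if "card (ends V E) = 1" "finite (branch_vertices V E)"
    using T.finite_tree_with_ray_if_finite_desc T.finite_desc_if_one_end that by blast
  have fin_ends: "finite (ends V E)" if "card (ends V E) = 1"
    using that by (simp add: card_ge_0_finite)
  show ?thesis
  proof (intro conjI impI iffI)
    assume DN: "DN_LLY E < \<infinity>"
    show "?D \<or> ?F" "finite (branch_vertices V E)"
      "int (card (branch_vertices V E)) \<le> \<lceil>real_of_ereal (DN_LLY E)\<rceil>"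
      by (rule shape[OF DN] T.card_branch_vertices_le_DN[OF DN])+
    show "\<not> (?D \<and> ?F)" using F(4) by blast
    show "finite (ends V E)" using shape[OF DN] D(2) F(2) fin_ends by blast
    show "card (ends V E) \<le> 2" using shape[OF DN] D(3) F(2) by linarith
    show ?D if "card (ends V E) = 2" using shape[OF DN] F(2) that by linarith
  next
    assume "(?D \<or> ?F) \<and> \<not> (?D \<and> ?F)"
    then show "DN_LLY E < \<infinity>" using D(1) F(1) by blast
  next
    assume ?F
    then show "card (ends V E) = 1" "finite (branch_vertices V E)" by (rule F)+
  next
    assume "card (ends V E) = 1 \<and> finite (branch_vertices V E)"
    then show ?F using one_end by blast
  qed
qed

end
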